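(* Let $(\rho,V)$ be an irreducible three dimensional complex representation of $\mathcal{LB}_3$ with $\rho(\sigma_1)=A$, $\rho(\sigma_2)=B$, with eigenvalues (with multiplicity) $\mathrm{Spec}(A)=\mathrm{Spec}(B)=\{\lambda_1,\lambda_2,\lambda_3\}$, and $\rho(s_1s_2)=S$. Then: (a) Any other representation $\psi$ of $\mathcal{LB}_3$ with $\psi(\sigma_1)=A$, $\psi(\sigma_2)=B$ and $\psi(s_1s_2)=S$ is also irreducible. (b) Suppose the minimal and characteristic polynomials of $A$ (and of $B$) coincide, $(AB)^3=cI$ for a scalar $c$, and $(\lambda_1+\lambda_2)(\lambda_1+\lambda_3)(\lambda_2+\lambda_3)\neq0$. Then $\rho(s_1s_2)=kAB$ for some $k\in\mathbb{C}$.
   Context: The three component loop braid group $\mathcal{LB}_3$ is the group generated by $\sigma_1,\sigma_2,s_1,s_2$ with relations $\sigma_1\sigma_2\sigma_1=\sigma_2\sigma_1\sigma_2$; $s_1s_2s_1=s_2s_1s_2$; $s_1^2=s_2^2=1$; $s_1s_2\sigma_1=\sigma_2s_1s_2$; $\sigma_1\sigma_2s_1=s_2\sigma_1\sigma_2$. *)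

theory Defs
  imports "Jordan_Normal_Form.Char_Poly" "Jordan_Normal_Form.VS_Connect"
begin

section \<open>Groups given by generators and relations\<close>

text \<open>A word over generators of type \<open>'g\<close>: the letter \<open>(g, True)\<close> stands for \<open>g\<close> and
  \<open>(g, False)\<close> for its inverse.\<close>

type_synonym 'g word = "('g \<times> bool) list"

text \<open>The least congruence on words that contains the relations \<open>R\<close> and makes the two letters of
  each generator mutually inverse.\<close>

inductive pres_eq :: "('g word \<times> 'g word) set \<Rightarrow> 'g word \<Rightarrow> 'g word \<Rightarrow> bool"
  for R :: "('g word \<times> 'g word) set" where
  refl: "pres_eq R u u"
| sym: "pres_eq R u v \<Longrightarrow> pres_eq R v u"
| trans: "pres_eq R u v \<Longrightarrow> pres_eq R v w \<Longrightarrow> pres_eq R u w"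
| append: "pres_eq R u u' \<Longrightarrow> pres_eq R v v' \<Longrightarrow> pres_eq R (u @ v) (u' @ v')"
| cancel: "pres_eq R [(g, b), (g, \<not> b)] []"
| rel: "(u, v) \<in> R \<Longrightarrow> pres_eq R u v"

definition pres_class :: "('g word \<times> 'g word) set \<Rightarrow> 'g word \<Rightarrow> 'g word set" where
  "pres_class R u = {v. pres_eq R u v}"

definition presented_group :: "('g word \<times> 'g word) set \<Rightarrow> 'g word set monoid" where
  "presented_group R =
    \<lparr>carrier = range (pres_class R),
     mult = (\<lambda>X Y. \<Union>x\<in>X. \<Union>y\<in>Y. pres_class R (x @ y)),
     one = pres_class R []\<rparr>"

lemma pres_class_eq_iff: "pres_class R u = pres_class R v \<longleftrightarrow> pres_eq R u v"
proof
  assume "pres_class R u = pres_class R v"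
  moreover have "v \<in> pres_class R v"
    by (simp add: pres_class_def pres_eq.refl)
  ultimately show "pres_eq R u v"
    by (simp add: pres_class_def set_eq_iff)
next
  assume "pres_eq R u v"
  then have "pres_eq R u w \<longleftrightarrow> pres_eq R v w" for w
    by (meson pres_eq.sym pres_eq.trans)
  then show "pres_class R u = pres_class R v"
    by (simp add: pres_class_def)
qed

lemma presented_group_mult:
  "pres_class R u \<otimes>\<^bsub>presented_group R\<^esub> pres_class R v = pres_class R (u @ v)"
proof -
  have "pres_class R (x @ y) = pres_class R (u @ v)"
    if "x \<in> pres_class R u" "y \<in> pres_class R v" for x y
  proof -
    have "pres_eq R (u @ v) (x @ y)"
      using that by (simp add: pres_class_def pres_eq.append)
    then show ?thesis
      by (simp add: pres_class_eq_iff pres_eq.sym)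
  qed
  moreover have "u \<in> pres_class R u" "v \<in> pres_class R v"
    by (simp_all add: pres_class_def pres_eq.refl)
  ultimately have "(\<Union>x\<in>pres_class R u. \<Union>y\<in>pres_class R v. pres_class R (x @ y)) =
      pres_class R (u @ v)"
    by blast
  then show ?thesis
    by (simp add: presented_group_def)
qed

lemma pres_eq_inverse:
  "pres_eq R (rev (map (\<lambda>(g, b). (g, \<not> b)) u) @ u) []"
proof (induction u)
  case Nil
  show ?case by (simp add: pres_eq.refl)
next
  case (Cons a u)
  obtain g b where a: "a = (g, b)" by (cases a)
  let ?v = "rev (map (\<lambda>(g, b). (g, \<not> b)) u)"
  have "pres_eq R ([(g, \<not> b), (g, \<not> \<not> b)] @ u) ([] @ u)"
    by (intro pres_eq.append pres_eq.cancel pres_eq.refl)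
  then have "pres_eq R (?v @ [(g, \<not> b), (g, b)] @ u) (?v @ u)"
    by (intro pres_eq.append pres_eq.refl) simp
  from pres_eq.trans[OF this Cons.IH] show ?case
    by (simp add: a)
qed

lemma group_presented_group: "group (presented_group R)"
proof (rule groupI)
  show "\<exists>y\<in>carrier (presented_group R). y \<otimes>\<^bsub>presented_group R\<^esub> x = \<one>\<^bsub>presented_group R\<^esub>"
    if x: "x \<in> carrier (presented_group R)" for x
  proof -
    obtain u where "x = pres_class R u"
      using x by (auto simp: presented_group_def)
    moreover have one: "\<one>\<^bsub>presented_group R\<^esub> = pres_class R []"
      by (simp add: presented_group_def)
    ultimately have "pres_class R (rev (map (\<lambda>(g, b). (g, \<not> b)) u)) \<otimes>\<^bsub>presented_group R\<^esub> x
        = \<one>\<^bsub>presented_group R\<^esub>"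
      by (simp add: presented_group_mult pres_class_eq_iff pres_eq_inverse)
    then show ?thesis
      by (intro bexI) (auto simp: presented_group_def)
  qed
next
  show "\<one>\<^bsub>presented_group R\<^esub> \<in> carrier (presented_group R)"
    by (simp add: presented_group_def)
next
  fix x y assume "x \<in> carrier (presented_group R)" "y \<in> carrier (presented_group R)"
  then obtain u v where "x = pres_class R u" "y = pres_class R v"
    by (auto simp: presented_group_def)
  then show "x \<otimes>\<^bsub>presented_group R\<^esub> y \<in> carrier (presented_group R)"
    by (simp only: presented_group_mult) (simp add: presented_group_def)
next
  fix x y z assume "x \<in> carrier (presented_group R)" "y \<in> carrier (presented_group R)"
    "z \<in> carrier (presented_group R)"
  then obtain u v w where "x = pres_class R u" "y = pres_class R v" "z = pres_class R w"
    by (auto simp: presented_group_def)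
  then show "x \<otimes>\<^bsub>presented_group R\<^esub> y \<otimes>\<^bsub>presented_group R\<^esub> z
      = x \<otimes>\<^bsub>presented_group R\<^esub> (y \<otimes>\<^bsub>presented_group R\<^esub> z)"
    by (simp add: presented_group_mult)
next
  fix x assume "x \<in> carrier (presented_group R)"
  then obtain u where u: "x = pres_class R u"
    by (auto simp: presented_group_def)
  have "\<one>\<^bsub>presented_group R\<^esub> = pres_class R []"
    by (simp add: presented_group_def)
  with u show "\<one>\<^bsub>presented_group R\<^esub> \<otimes>\<^bsub>presented_group R\<^esub> x = x"
    by (simp add: presented_group_mult)
qed

section \<open>The three component loop braid group\<close>

datatype lb3_gen = Sigma1 | Sigma2 | S1 | S2

definition pos_word :: "'g list \<Rightarrow> 'g word" where
  "pos_word = map (\<lambda>g. (g, True))"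

definition lb3_relations :: "(lb3_gen word \<times> lb3_gen word) set" where
  "lb3_relations = (\<lambda>(u, v). (pos_word u, pos_word v)) `
    {([Sigma1, Sigma2, Sigma1], [Sigma2, Sigma1, Sigma2]),
     ([S1, S2, S1], [S2, S1, S2]),
     ([S1, S1], []),
     ([S2, S2], []),
     ([S1, S2, Sigma1], [Sigma2, S1, S2]),
     ([Sigma1, Sigma2, S1], [S2, Sigma1, Sigma2])}"

definition LB3 :: "lb3_gen word set monoid" where
  "LB3 = presented_group lb3_relations"

definition lb3 :: "lb3_gen \<Rightarrow> lb3_gen word set" where
  "lb3 g = pres_class lb3_relations (pos_word [g])"

lemma group_LB3: "group LB3"
  unfolding LB3_def by (rule group_presented_group)

lemma lb3_in_carrier: "lb3 g \<in> carrier LB3"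
  by (simp add: lb3_def LB3_def presented_group_def)

section \<open>Complex matrix representations\<close>

definition GL :: "nat \<Rightarrow> complex mat monoid" where
  "GL n = units_of (ring_mat TYPE(complex) n ())"

definition representation :: "('a, 'b) monoid_scheme \<Rightarrow> nat \<Rightarrow> ('a \<Rightarrow> complex mat) \<Rightarrow> bool" where
  "representation G n \<rho> \<longleftrightarrow> \<rho> \<in> hom G (GL n)"

definition irreducible_representation ::
    "('a, 'b) monoid_scheme \<Rightarrow> nat \<Rightarrow> ('a \<Rightarrow> complex mat) \<Rightarrow> bool" where
  "irreducible_representation G n \<rho> \<longleftrightarrow>
     representation G n \<rho> \<and> n > 0 \<and>
     (\<forall>W. VectorSpace.subspace class_ring W (module_vec TYPE(complex) n) \<and>
          (\<forall>g\<in>carrier G. \<forall>w\<in>W. \<rho> g *\<^sub>v w \<in> W) \<longrightarrow>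
          W = {0\<^sub>v n} \<or> W = carrier_vec n)"

section \<open>Minimal polynomials of matrices\<close>

definition poly_mat :: "'a::comm_ring_1 poly \<Rightarrow> 'a mat \<Rightarrow> 'a mat" where
  "poly_mat p A = mat (dim_row A) (dim_row A)
     (\<lambda>(i, j). \<Sum>k\<le>degree p. coeff p k * (A ^\<^sub>m k) $$ (i, j))"

definition is_minimal_poly :: "'a::field mat \<Rightarrow> 'a poly \<Rightarrow> bool" where
  "is_minimal_poly A p \<longleftrightarrow>
     monic p \<and> poly_mat p A = 0\<^sub>m (dim_row A) (dim_row A) \<and>
     (\<forall>q. q \<noteq> 0 \<and> poly_mat q A = 0\<^sub>m (dim_row A) (dim_row A) \<longrightarrow> degree p \<le> degree q)"

end

(*
  Put S = s1 s2, t = s1 and T = S^-1 A B. The relations say that B = S A S^-1, that S and t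
  generate a quotient of the symmetric group S_3, and that T commutes with A and with t. If S = 1
  then A^2 = T is central and the representation is reducible; so S has the three cube roots of
  unity as eigenvalues, and in an eigenbasis S is diagonal and t is a signed permutation matrix.

  (a) If psi has the same A and S, then t psi(s1) commutes with S, hence is a polynomial in S, so
  subspaces invariant under psi are invariant under rho.

  (b) (S T)^3 is scalar, which forces T to commute with S T S^-1. If T is not scalar then the
  coordinates in the eigenbasis of S show that T is a scalar plus a matrix N of rank one. As A
  commutes with N, either A, S, t have a common invariant subspace, or the range of N is an
  eigenline of A with eigenvalue x and A S A = S T S gives tr A = x, so two eigenvalues of A have
  sum zero. Hence T is scalar, which is the claim.
*)
theory Submission
  imports Defs
begin

section \<open>Three by three matrices\<close>

text \<open>With \<open>B\<close> written as \<open>S A S^-1\<close>, the braid relation says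
  exactly that \<open>T\<close> commutes with \<open>A\<close>; with \<open>s2 = t S\<close>, the
  mixed relation says exactly that \<open>T\<close> commutes with \<open>t\<close>. Only
  \<open>S\<close> may fail to commute with \<open>T\<close>, and (b) controls this through the
  conjugate \<open>S T S^-1\<close>.

  Odd dimension enters twice. An involution inverting \<open>S\<close> exchanges the eigenspaces for
  the two primitive cube roots of unity, so the eigenvalue 1 must occur, and S \<noteq> 1 makes the
  other two occur as well. If S = 1, a suitable combination of \<open>A\<close> and \<open>t\<close>
  anticommutes with \<open>t\<close> and is therefore singular; its kernel is invariant.

  The product of the pairwise sums of eigenvalues is the value of the characteristic polynomial of
  \<open>A\<close> at its trace, so its being nonzero says that the trace is not an eigenvalue. The
  trace is reached by averaging over conjugation by the powers of \<open>S\<close>: in an eigenbasis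
  of \<open>S\<close> this keeps the diagonal of a matrix and deletes the rest.\<close>

lemmas assoc3 = assoc_mult_mat[of _ 3 3 _ 3 _ 3]

lemma mult_carrier_mat3 [simp]:
  "A \<in> carrier_mat 3 3 \<Longrightarrow> B \<in> carrier_mat 3 3 \<Longrightarrow> A * B \<in> carrier_mat 3 3"
  by (rule mult_carrier_mat)

lemma smult_smult_mat [simp]: "a \<cdot>\<^sub>m (b \<cdot>\<^sub>m A) = (a * b :: 'a::semigroup_mult) \<cdot>\<^sub>m A"
  by (rule eq_matI) (auto simp: mult.assoc)

lemma mult_mat_zero_vec [simp]:
  "A \<in> carrier_mat nr nc \<Longrightarrow> A *\<^sub>v 0\<^sub>v nc = (0\<^sub>v nr :: 'a::semiring_0 vec)"
  by (intro eq_vecI) auto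

lemma less3_cases: "i < (3::nat) \<longleftrightarrow> i = 0 \<or> i = Suc 0 \<or> i = 2"
  by auto

lemma mat3_eqI:
  assumes "A \<in> carrier_mat 3 3" "B \<in> carrier_mat 3 3"
    and "\<And>i j. i < 3 \<Longrightarrow> j < 3 \<Longrightarrow> A $$ (i, j) = B $$ (i, j)"
  shows "A = B"
  using assms by (intro eq_matI) auto

section \<open>Entrywise formulas, Cayley-Hamilton and the trace in dimension three\<close>

lemma mult_mat3_index:
  assumes "A \<in> carrier_mat 3 3" "B \<in> carrier_mat 3 3" "i < 3" "j < 3"
  shows "(A * B) $$ (i, j) =
    A $$ (i, 0) * B $$ (0, j) + A $$ (i, Suc 0) * B $$ (Suc 0, j) + A $$ (i, 2) * B $$ (2, j)"
  using assms by (auto simp: scalar_prod_def eval_nat_numeral)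

lemma det_mat2:
  fixes A :: "'a::comm_ring_1 mat"
  assumes "A \<in> carrier_mat 2 2"
  shows "det A = A $$ (0, 0) * A $$ (Suc 0, Suc 0) - A $$ (0, Suc 0) * A $$ (Suc 0, 0)"
  using assms
  by (subst laplace_expansion_column[of _ 2 0])
    (auto simp: eval_nat_numeral cofactor_def mat_delete_def det_single[of _] algebra_simps)

lemma det_mat3:
  fixes A :: "'a::comm_ring_1 mat"
  assumes "A \<in> carrier_mat 3 3"
  shows "det A =
      A $$ (0, 0) * (A $$ (Suc 0, Suc 0) * A $$ (2, 2) - A $$ (Suc 0, 2) * A $$ (2, Suc 0))
    - A $$ (Suc 0, 0) * (A $$ (0, Suc 0) * A $$ (2, 2) - A $$ (0, 2) * A $$ (2, Suc 0))
    + A $$ (2, 0) * (A $$ (0, Suc 0) * A $$ (Suc 0, 2) - A $$ (0, 2) * A $$ (Suc 0, Suc 0))"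
proof -
  have d: "det (mat_delete A i 0) =
      mat_delete A i 0 $$ (0, 0) * mat_delete A i 0 $$ (Suc 0, Suc 0)
    - mat_delete A i 0 $$ (0, Suc 0) * mat_delete A i 0 $$ (Suc 0, 0)" for i
    using assms by (intro det_mat2) (auto simp: mat_delete_def)
  have "det A = (\<Sum>i<3. A $$ (i, 0) * cofactor A i 0)"
    using assms by (intro laplace_expansion_column) auto
  also have "\<dots> = A $$ (0, 0) * cofactor A 0 0 + A $$ (Suc 0, 0) * cofactor A (Suc 0) 0
      + A $$ (2, 0) * cofactor A 2 0"
    by (simp add: eval_nat_numeral)
  finally show ?thesis
    using assms by (simp add: cofactor_def d) (simp add: mat_delete_def eval_nat_numeral algebra_simps)
qed

text \<open>Cayley-Hamilton. A subspace preserved by a matrix is preserved by polynomials in it, so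
  invariance under a generator passes to its inverse.\<close>

lemma inverse_mat3_polynomial:
  fixes A B :: "'a::field mat"
  assumes A: "A \<in> carrier_mat 3 3" and B: "B \<in> carrier_mat 3 3" and AB: "A * B = 1\<^sub>m 3"
  shows "\<exists>a b c. B = a \<cdot>\<^sub>m 1\<^sub>m 3 + b \<cdot>\<^sub>m A + c \<cdot>\<^sub>m (A * A)"
proof -
  \<comment> \<open>\<open>u\<close> is the trace, \<open>v\<close> the sum of the principal minors
    of size two, and \<open>C\<close> the adjugate of \<open>A\<close>.\<close>
  define u where "u = A $$ (0, 0) + A $$ (Suc 0, Suc 0) + A $$ (2, 2)"
  define v where "v = A $$ (0, 0) * A $$ (Suc 0, Suc 0) + A $$ (0, 0) * A $$ (2, 2)
    + A $$ (Suc 0, Suc 0) * A $$ (2, 2) - A $$ (0, Suc 0) * A $$ (Suc 0, 0)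
    - A $$ (0, 2) * A $$ (2, 0) - A $$ (Suc 0, 2) * A $$ (2, Suc 0)"
  define C where "C = v \<cdot>\<^sub>m 1\<^sub>m 3 + (- u) \<cdot>\<^sub>m A + A * A"
  have C: "C \<in> carrier_mat 3 3" using A by (simp add: C_def)
  have det: "det A \<noteq> 0"
    using arg_cong[OF AB, of det] A B by (auto simp: det_mult)
  have "C * A = det A \<cdot>\<^sub>m 1\<^sub>m 3"
  proof (rule mat3_eqI)
    fix i j :: nat assume "i < 3" "j < 3"
    then show "(C * A) $$ (i, j) = (det A \<cdot>\<^sub>m 1\<^sub>m 3) $$ (i, j)"
      using A C unfolding less3_cases
      by (elim disjE; simp add: mult_mat3_index det_mat3[OF A] C_def u_def v_def algebra_simps
          del: index_mult_mat(1))
  qed (use A C in auto)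
  then have "C * A * B = (det A \<cdot>\<^sub>m 1\<^sub>m 3) * B" by simp
  then have CB: "C = det A \<cdot>\<^sub>m B"
    using A B C by (simp add: assoc3 AB mult_smult_assoc_mat[of _ 3 3 _ 3])
  have "B = (v / det A) \<cdot>\<^sub>m 1\<^sub>m 3 + (- u / det A) \<cdot>\<^sub>m A + (1 / det A) \<cdot>\<^sub>m (A * A)"
  proof (rule mat3_eqI)
    fix i j :: nat assume ij: "i < 3" "j < 3"
    have "C $$ (i, j) = det A * B $$ (i, j)"
      using ij B by (simp add: CB)
    then have "B $$ (i, j) = C $$ (i, j) / det A" using det by simp
    then show "B $$ (i, j) = ((v / det A) \<cdot>\<^sub>m 1\<^sub>m 3 + (- u / det A) \<cdot>\<^sub>m A + (1 / det A) \<cdot>\<^sub>m (A * A)) $$ (i, j)"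
      using ij A det by (simp add: C_def add_divide_distrib diff_divide_distrib del: index_mult_mat(1))
  qed (use A B in auto)
  then show ?thesis by blast
qed

lemma char_poly_mat3_trace:
  fixes A :: "complex mat"
  assumes A: "A \<in> carrier_mat 3 3"
    and cp: "char_poly A = [:- l1, 1:] * [:- l2, 1:] * [:- l3, 1:]"
  shows "A $$ (0, 0) + A $$ (Suc 0, Suc 0) + A $$ (2, 2) = l1 + l2 + l3"
proof -
  have "coeff (char_poly A) 2 = - (A $$ (0, 0) + A $$ (Suc 0, Suc 0) + A $$ (2, 2))"
    using A
    by (simp add: char_poly_def det_mat3[of "char_poly_matrix A"])
      (simp add: char_poly_matrix_def eval_nat_numeral algebra_simps)
  moreover have "coeff (char_poly A) 2 = - (l1 + l2 + l3)"
    by (simp add: cp eval_nat_numeral)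
  ultimately show ?thesis by (metis neg_equal_iff_equal)
qed


lemmas mat3_ring_simps = assoc3
  add_mult_distrib_mat[of _ 3 3 _ _ 3] mult_add_distrib_mat[of _ 3 3 _ 3]
  mult_smult_distrib[of _ 3 3 _ 3] mult_smult_assoc_mat[of _ 3 3 _ 3]

definition diag3 :: "'a::zero \<Rightarrow> 'a \<Rightarrow> 'a \<Rightarrow> 'a mat" where
  "diag3 a b c = mat 3 3 (\<lambda>(i, j). if i = j then [a, b, c] ! i else 0)"

lemma diag3_carrier [simp]: "diag3 a b c \<in> carrier_mat 3 3"
  by (simp add: diag3_def)

lemma diag3_index [simp]:
  "diag3 a b c $$ (0, 0) = a" "diag3 a b c $$ (Suc 0, Suc 0) = b" "diag3 a b c $$ (2, 2) = c"
  "diag3 a b c $$ (0, Suc 0) = 0" "diag3 a b c $$ (0, 2) = 0" "diag3 a b c $$ (Suc 0, 0) = 0"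
  "diag3 a b c $$ (Suc 0, 2) = 0" "diag3 a b c $$ (2, 0) = 0" "diag3 a b c $$ (2, Suc 0) = 0"
  by (simp_all add: diag3_def)

lemma diag3_dim [simp]: "dim_row (diag3 a b c) = 3" "dim_col (diag3 a b c) = 3"
  by (simp_all add: diag3_def)

lemma det_diag3 [simp]: "det (diag3 a b c) = a * b * (c::'a::comm_ring_1)"
  by (simp add: det_mat3)

section \<open>Irreducible sets of matrices\<close>

text \<open>If \<open>X A = M X\<close> then the kernel of \<open>X\<close> is invariant under \<open>A\<close>, and conversely every
  common invariant subspace is the kernel of such an \<open>X\<close>. In this form irreducibility is
  visibly preserved by simultaneous conjugation.\<close>

definition irreducible3 :: "complex mat set \<Rightarrow> bool" where
  "irreducible3 G \<longleftrightarrow> (\<forall>X \<in> carrier_mat 3 3. det X = 0 \<and>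
     (\<forall>A\<in>G. \<exists>M \<in> carrier_mat 3 3. X * A = M * X) \<longrightarrow> X = 0\<^sub>m 3 3)"

lemma irreducible3D:
  assumes "irreducible3 G" "X \<in> carrier_mat 3 3" "det X = 0"
    and "\<And>A. A \<in> G \<Longrightarrow> \<exists>M \<in> carrier_mat 3 3. X * A = M * X"
  shows "X = 0\<^sub>m 3 3"
  using assms by (auto simp: irreducible3_def)

text \<open>A witness \<open>X\<close> of reducibility for the conjugates \<open>Q * A * P\<close>
  gives the witness \<open>X * Q\<close> for the original matrices, with the same
  \<open>M\<close>.\<close>

lemma irreducible3_conjugate:
  assumes irr: "irreducible3 G" and G: "G \<subseteq> carrier_mat 3 3"
    and P: "P \<in> carrier_mat 3 3" and Q: "Q \<in> carrier_mat 3 3"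
    and PQ: "P * Q = 1\<^sub>m 3" and QP: "Q * P = 1\<^sub>m 3"
  shows "irreducible3 ((\<lambda>A. Q * A * P) ` G)"
  unfolding irreducible3_def
proof (intro ballI impI, elim conjE)
  fix X :: "complex mat"
  assume X: "X \<in> carrier_mat 3 3" and det: "det X = 0"
    and inv: "\<forall>A\<in>(\<lambda>A. Q * A * P) ` G. \<exists>M\<in>carrier_mat 3 3. X * A = M * X"
  have "X * Q = 0\<^sub>m 3 3"
  proof (rule irreducible3D[OF irr])
    show "det (X * Q) = 0" using X Q det by (simp add: det_mult)
    fix A assume "A \<in> G"
    then have A: "A \<in> carrier_mat 3 3" using G by auto
    obtain M where M: "M \<in> carrier_mat 3 3" "X * (Q * A * P) = M * X"
      using inv \<open>A \<in> G\<close> by auto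
    then have "X * (Q * A * P) * Q = M * X * Q" by simp
    then have "X * Q * A = M * (X * Q)"
      using X Q P A M(1) by (simp add: assoc3 PQ)
    then show "\<exists>M\<in>carrier_mat 3 3. X * Q * A = M * (X * Q)" using M(1) by blast
  qed (use X Q in simp)
  then have "X * Q * P = 0\<^sub>m 3 3" using P by simp
  then show "X = 0\<^sub>m 3 3" using X Q P by (simp add: assoc3 QP)
qed

section \<open>Schur's lemma and its consequences\<close>

lemma eigenvalue_exists:
  assumes "T \<in> carrier_mat n n" "n > 0"
  shows "\<exists>c::complex. eigenvalue T c"
proof -
  obtain as where "char_poly T = (\<Prod>a\<leftarrow>as. [:- a, 1:])" "length as = n"
    using char_poly_factorized[OF assms(1)] by auto
  then have "poly (char_poly T) (hd as) = 0" using assms(2) by (cases as) auto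
  then show ?thesis using eigenvalue_root_char_poly[OF assms(1)] by auto
qed

text \<open>For an eigenvalue \<open>c\<close> of \<open>T\<close> the singular matrix
  \<open>T - c\<close> commutes with \<open>G\<close>, so it is an admissible \<open>X\<close> with
  \<open>M = A\<close>.\<close>

lemma irreducible3_Schur:
  assumes irr: "irreducible3 G" and T: "T \<in> carrier_mat 3 3" and G: "G \<subseteq> carrier_mat 3 3"
    and comm: "\<And>A. A \<in> G \<Longrightarrow> T * A = A * T"
  shows "\<exists>c. T = c \<cdot>\<^sub>m 1\<^sub>m 3"
proof -
  obtain c where "eigenvalue T c" using eigenvalue_exists[OF T] by auto
  then have det: "det (T + (- c) \<cdot>\<^sub>m 1\<^sub>m 3) = 0"
    using eigenvalue_det[OF T] T by (simp add: char_matrix_def)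
  have zero: "T + (- c) \<cdot>\<^sub>m 1\<^sub>m 3 = 0\<^sub>m 3 3"
  proof (rule irreducible3D[OF irr _ det])
    fix A assume "A \<in> G"
    then have A: "A \<in> carrier_mat 3 3" using G by auto
    have "(T + (- c) \<cdot>\<^sub>m 1\<^sub>m 3) * A = A * (T + (- c) \<cdot>\<^sub>m 1\<^sub>m 3)"
      using A T comm[OF \<open>A \<in> G\<close>] by (simp add: mat3_ring_simps)
    then show "\<exists>M\<in>carrier_mat 3 3. (T + (- c) \<cdot>\<^sub>m 1\<^sub>m 3) * A = M * (T + (- c) \<cdot>\<^sub>m 1\<^sub>m 3)"
      using A by auto
  qed (use T in simp)
  have "T = c \<cdot>\<^sub>m 1\<^sub>m 3"
  proof (rule mat3_eqI)
    fix i j :: nat assume "i < 3" "j < 3"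
    then have "(T + (- c) \<cdot>\<^sub>m 1\<^sub>m 3) $$ (i, j) = 0" by (simp only: zero) simp
    then show "T $$ (i, j) = (c \<cdot>\<^sub>m 1\<^sub>m 3) $$ (i, j)"
      using T \<open>i < 3\<close> \<open>j < 3\<close> by (auto split: if_splits)
  qed (use T in auto)
  then show ?thesis ..
qed

text \<open>Scalar matrices preserve every subspace, in particular the kernel of the projection
  \<open>diag3 1 0 0\<close>.\<close>

lemma irreducible3_not_all_scalar:
  assumes "irreducible3 G" shows "\<exists>A\<in>G. \<forall>c. A \<noteq> c \<cdot>\<^sub>m 1\<^sub>m 3"
proof (rule ccontr)
  assume scalar: "\<not> ?thesis"
  have "diag3 1 0 0 = (0\<^sub>m 3 3 :: complex mat)"
  proof (rule irreducible3D[OF assms])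
    fix A assume "A \<in> G"
    then obtain c where "A = c \<cdot>\<^sub>m 1\<^sub>m 3" using scalar by auto
    then have "diag3 1 0 0 * A = A * diag3 1 0 0" "A \<in> carrier_mat 3 3"
      by (simp_all add: mat3_ring_simps right_mult_one_mat[of _ 3 3] left_mult_one_mat[of _ 3 3])
    then show "\<exists>M\<in>carrier_mat 3 3. diag3 1 0 0 * A = M * diag3 1 0 0" by blast
  qed simp_all
  then have "diag3 1 0 0 $$ (0, 0) = (0\<^sub>m 3 3 :: complex mat) $$ (0, 0)" by simp
  then show False by simp
qed

text \<open>With \<open>A\<^sup>2\<close> central and \<open>t\<^sup>2 = 1\<close>, the anticommutator of \<open>A\<close> and \<open>t\<close> is central, and a multiple
  of \<open>t\<close> can be subtracted from \<open>A\<close> to get a matrix anticommuting with \<open>t\<close>, which is singular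
  because the dimension is odd.\<close>

lemma irreducible3_pair_square_not_central:
  assumes irr: "irreducible3 {A, 1\<^sub>m 3, t}"
    and A: "A \<in> carrier_mat 3 3" and t: "t \<in> carrier_mat 3 3" and tt: "t * t = 1\<^sub>m 3"
  shows "A * A * t \<noteq> t * (A * A)"
proof
  assume AAt: "A * A * t = t * (A * A)"
  have tt': "t * (t * X) = X" if "X \<in> carrier_mat 3 3" for X
    using assoc3[of t t X] t that by (simp add: tt)
  have "\<exists>c. A * t + t * A = c \<cdot>\<^sub>m 1\<^sub>m 3"
  proof (rule irreducible3_Schur[OF irr])
    fix Y assume "Y \<in> {A, 1\<^sub>m 3, t}"
    then show "(A * t + t * A) * Y = Y * (A * t + t * A)"
      using A t AAt
      by (auto simp: mat3_ring_simps tt tt' right_mult_one_mat[of _ 3 3] left_mult_one_mat[of _ 3 3]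
          comm_add_mat[of _ 3 3])
  qed (use A t in auto)
  then obtain c where c: "A * t + t * A = c \<cdot>\<^sub>m 1\<^sub>m 3" ..
  \<comment> \<open>As \<open>t * t = 1\<close>, subtracting \<open>c / 2\<close> times
    \<open>t\<close> lowers the anticommutator with \<open>t\<close> from \<open>c\<close> to
    0.\<close>
  define C where "C = A + (- c / 2) \<cdot>\<^sub>m t"
  have C: "C \<in> carrier_mat 3 3" using A t by (simp add: C_def)
  have AC: "A = C + (c / 2) \<cdot>\<^sub>m t"
    by (rule mat3_eqI) (use A t in \<open>auto simp: C_def\<close>)
  have Ct: "C * t = (- 1) \<cdot>\<^sub>m (t * C)"
  proof (rule mat3_eqI)
    fix i j :: nat assume ij: "i < 3" "j < 3"
    define p q d where "p = (A * t) $$ (i, j)" and "q = (t * A) $$ (i, j)"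
      and "d = (1\<^sub>m 3 :: complex mat) $$ (i, j)"
    have "(A * t + t * A) $$ (i, j) = (c \<cdot>\<^sub>m 1\<^sub>m 3) $$ (i, j)" by (simp only: c)
    then have p: "p = c * d - q"
      using A t ij by (simp add: eq_diff_eq p_def q_def d_def del: index_mult_mat(1))
    have "C * t = A * t + (- c / 2) \<cdot>\<^sub>m 1\<^sub>m 3" "t * C = t * A + (- c / 2) \<cdot>\<^sub>m 1\<^sub>m 3"
      using A t by (simp_all add: C_def mat3_ring_simps tt)
    then have "(C * t) $$ (i, j) = p - c / 2 * d" "(t * C) $$ (i, j) = q - c / 2 * d"
      using A t ij by (simp_all add: p_def q_def d_def del: index_mult_mat(1))
    moreover have "p - c / 2 * d = - (q - c / 2 * d)"
      unfolding p by (simp add: field_simps)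
    ultimately show "(C * t) $$ (i, j) = ((- 1) \<cdot>\<^sub>m (t * C)) $$ (i, j)"
      using C t ij by (simp del: index_mult_mat(1))
  qed (use C t in auto)
  \<comment> \<open>Conjugation by \<open>t\<close> turns \<open>C\<close> into \<open>- C\<close>,
    whose determinant is \<open>(-1)^3 det C\<close>.\<close>
  have "det (t * (C * t)) = det (t * ((- 1) \<cdot>\<^sub>m (t * C)))" by (simp only: Ct)
  also have "\<dots> = det ((- 1) \<cdot>\<^sub>m C)"
    using C t by (simp add: mat3_ring_simps tt')
  also have "\<dots> = - det C" using C by simp
  finally have "det t * det t * det C = - det C"
    using C t by (simp add: det_mult[of _ 3] mult_ac)
  moreover have "det t * det t = 1"
    using arg_cong[OF tt, of det] t by (simp add: det_mult[of _ 3])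
  ultimately have det: "det C = 0" by simp
  have "C = 0\<^sub>m 3 3"
  proof (rule irreducible3D[OF irr C det])
    fix Y assume "Y \<in> {A, 1\<^sub>m 3, t}"
    \<comment> \<open>Moving \<open>C\<close> past \<open>A = C + (c / 2) t\<close> flips the sign
      of the \<open>t\<close> part; the kernel of \<open>C\<close> is therefore invariant.\<close>
    moreover have "C * A = (C + (- c / 2) \<cdot>\<^sub>m t) * C"
      unfolding AC using C t
      by (simp add: mat3_ring_simps Ct)
    moreover have "C * t = ((- 1) \<cdot>\<^sub>m t) * C" using C t by (simp add: mat3_ring_simps Ct)
    moreover have "C * 1\<^sub>m 3 = 1\<^sub>m 3 * C" using C by simp
    ultimately show "\<exists>M\<in>carrier_mat 3 3. C * Y = M * C"
      using C t
      by (metis add_carrier_mat smult_carrier_mat one_carrier_mat insertE singletonD)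
  qed
  then have At: "A = (c / 2) \<cdot>\<^sub>m t" using AC t by simp
  have "\<exists>d. t = d \<cdot>\<^sub>m 1\<^sub>m 3"
    by (rule irreducible3_Schur[OF irr t]) (use A t in \<open>auto simp: At mat3_ring_simps\<close>)
  then obtain d where d: "t = d \<cdot>\<^sub>m 1\<^sub>m 3" ..
  have "A = (c / 2 * d) \<cdot>\<^sub>m 1\<^sub>m 3" unfolding At d by (auto intro!: mat3_eqI)
  moreover have "1\<^sub>m 3 = 1 \<cdot>\<^sub>m (1\<^sub>m 3 :: complex mat)" by (auto intro!: mat3_eqI)
  ultimately show False
    using irreducible3_not_all_scalar[OF irr] d by blast
qed


section \<open>The symmetric group on three letters in coordinates\<close>

text \<open>The shape of \<open>t\<close> in an eigenbasis of \<open>S\<close>: \<open>e\<close> is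
  the sign on the eigenvector for 1, and the eigenvectors for the two primitive cube roots are
  exchanged.\<close>

definition swap3 :: "complex \<Rightarrow> complex mat" where
  "swap3 e = mat 3 3 (\<lambda>(i, j). if i = 0 \<and> j = 0 then e
     else if i = 1 \<and> j = 2 \<or> i = 2 \<and> j = 1 then 1 else 0)"

lemma swap3_carrier [simp]: "swap3 e \<in> carrier_mat 3 3"
  by (simp add: swap3_def)

lemma swap3_index [simp]:
  "swap3 e $$ (0, 0) = e" "swap3 e $$ (Suc 0, Suc 0) = 0" "swap3 e $$ (2, 2) = 0"
  "swap3 e $$ (0, Suc 0) = 0" "swap3 e $$ (0, 2) = 0" "swap3 e $$ (Suc 0, 0) = 0"
  "swap3 e $$ (Suc 0, 2) = 1" "swap3 e $$ (2, 0) = 0" "swap3 e $$ (2, Suc 0) = 1"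
  by (simp_all add: swap3_def)

text \<open>The equation of a primitive cube root of unity, oriented so that rewriting lowers
  polynomials in \<open>w\<close> to degree one.\<close>

lemma cube_root_of_unity:
  obtains w :: complex where "w * w = - 1 - w"
proof
  show "(csqrt (-3) / 2 - 1 / 2) * (csqrt (-3) / 2 - 1 / 2) = - 1 - (csqrt (-3) / 2 - 1 / 2)"
    using power2_csqrt[of "-3"] by (simp add: field_simps power2_eq_square)
qed

lemma cube_root_of_unity_neq:
  fixes w :: complex
  assumes "w * w = - 1 - w"
  shows "w \<noteq> 1" "w \<noteq> 0" "w \<noteq> w * w" "w * w \<noteq> 1" "w * (w * w) = 1"
proof -
  show "w \<noteq> 1" "w \<noteq> 0" using assms by auto
  show 3: "w * (w * w) = 1" by (simp add: algebra_simps assms)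
  show "w * w \<noteq> 1" using 3 \<open>w \<noteq> 1\<close> by auto
  show "w \<noteq> w * w" using \<open>w \<noteq> 1\<close> \<open>w \<noteq> 0\<close> by simp
qed

text \<open>The basis consists of a fixed vector \<open>u0\<close> of \<open>S\<close>, an
  eigenvector \<open>u1\<close> for \<open>w\<close>, and \<open>t\<close> applied to
  \<open>u1\<close>, which has eigenvalue \<open>w * w\<close> because \<open>t\<close> inverts
  \<open>S\<close>.\<close>

lemma diagonalize_S3:
  fixes S t :: "complex mat"
  assumes S: "S \<in> carrier_mat 3 3" and t: "t \<in> carrier_mat 3 3"
    and SSS: "S * (S * S) = 1\<^sub>m 3" and tt: "t * t = 1\<^sub>m 3" and tS: "t * S = S * (S * t)"
    and S1: "S \<noteq> 1\<^sub>m 3" and w: "w * w = - 1 - w"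
  obtains P Q e where "P \<in> carrier_mat 3 3" "Q \<in> carrier_mat 3 3"
    "P * Q = 1\<^sub>m 3" "Q * P = 1\<^sub>m 3" "e * e = 1"
    "Q * S * P = diag3 1 w (w * w)" "Q * t * P = swap3 e"
proof -
  note w_neq = cube_root_of_unity_neq[OF w]
  have w': "w * (w * x) = - x - w * x" for x
    using arg_cong[OF w, of "\<lambda>y. y * x"] by (simp add: algebra_simps)
  have tt': "t * (t * X) = X" if "X \<in> carrier_mat 3 3" for X
    using assoc3[of t t X] t that by (simp add: tt)
  have SSS': "S * (S * (S * X)) = X" if "X \<in> carrier_mat 3 3" for X
  proof -
    have "S * (S * (S * X)) = (S * (S * S)) * X" using S that by (simp add: assoc3)
    then show ?thesis using that by (simp add: SSS)
  qed
  have tS': "t * (S * X) = S * (S * (t * X))" if "X \<in> carrier_mat 3 3" for X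
  proof -
    have "t * (S * X) = (t * S) * X" using S t that by (simp add: assoc3)
    also have "\<dots> = S * (S * (t * X))" using S t that by (simp add: assoc3 tS)
    finally show ?thesis .
  qed
  have St: "S * t = t * (S * S)"
    using S t by (simp add: tS' tS SSS' assoc3)
  have det_t: "det t * det t = 1"
    using arg_cong[OF tt, of det] t by (simp add: det_mult[of _ 3])
  \<comment> \<open>\<open>t * S * t = S * S\<close> makes the determinant idempotent, while its
    cube is 1.\<close>
  have det_S: "det S = 1"
  proof -
    have "det S * (det S * det S) = 1"
      using arg_cong[OF SSS, of det] S by (simp add: det_mult[of _ 3])
    moreover have "det t * det S = det S * (det S * det t)"
      using arg_cong[OF tS, of det] S t by (simp add: det_mult[of _ 3])
    moreover have "det S = det t * (det t * det S)" by (simp add: det_t flip: mult.assoc)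
    ultimately have "det S = det t * (det S * (det S * det t))" by metis
    also have "\<dots> = det t * det t * (det S * det S)" by (simp only: mult_ac)
    finally have "det S * det S = det S" by (simp add: det_t)
    then show ?thesis using \<open>det S * (det S * det S) = 1\<close> by auto
  qed
  define C where "C = S + (- 1) \<cdot>\<^sub>m 1\<^sub>m 3"
  have C: "C \<in> carrier_mat 3 3" using S by (simp add: C_def)
  \<comment> \<open>The dimension is odd, so this makes \<open>S - 1\<close> singular.\<close>
  have "S * (t * (C * t)) = (- 1) \<cdot>\<^sub>m C"
  proof -
    have "S * (t * (C * t)) = 1\<^sub>m 3 + (- 1) \<cdot>\<^sub>m S"
      using S t by (simp add: C_def mat3_ring_simps tS' tt SSS)
    also have "\<dots> = (- 1) \<cdot>\<^sub>m C"
      using S unfolding C_def by (intro mat3_eqI) auto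
    finally show ?thesis .
  qed
  then have "det (S * (t * (C * t))) = det ((- 1) \<cdot>\<^sub>m C)"
    by (rule arg_cong)
  then have "det t * det t * det C = - det C"
    using S t C by (simp add: det_mult[of _ 3] det_S mult_ac)
  then have "det (char_matrix S 1) = 0"
    using S by (simp add: det_t char_matrix_def C_def)
  then obtain u0 where u0: "u0 \<in> carrier_vec 3" "u0 \<noteq> 0\<^sub>v 3" "S *\<^sub>v u0 = u0"
    using eigenvalue_det[OF S, of 1] S by (auto simp: eigenvalue_def eigenvector_def)
  \<comment> \<open>Three times the projection onto the eigenspace of \<open>S\<close> for
    \<open>w\<close>; any nonzero column serves as \<open>u1\<close>.\<close>
  define N where "N = 1\<^sub>m 3 + (w * w) \<cdot>\<^sub>m S + w \<cdot>\<^sub>m (S * S)"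
  have N: "N \<in> carrier_mat 3 3" using S by (simp add: N_def)
  have SN: "S * N = w \<cdot>\<^sub>m N"
  proof (rule mat3_eqI)
    fix i j :: nat assume ij: "i < 3" "j < 3"
    have "S * N = S + (w * w) \<cdot>\<^sub>m (S * S) + w \<cdot>\<^sub>m 1\<^sub>m 3"
      using S by (simp add: N_def mat3_ring_simps SSS)
    then show "(S * N) $$ (i, j) = (w \<cdot>\<^sub>m N) $$ (i, j)"
      using ij S w_neq(5) by (simp add: N_def algebra_simps del: index_mult_mat(1))
  qed (use S N in auto)
  have "N \<noteq> 0\<^sub>m 3 3"
  proof
    assume N0: "N = 0\<^sub>m 3 3"
    \<comment> \<open>Conjugation by \<open>t\<close> shows that the projection for
      \<open>w * w\<close> vanishes too; the difference of the two equations is a nonzero multiple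
      of \<open>S - S * S\<close>.\<close>
    have N0': "1\<^sub>m 3 + (w * w) \<cdot>\<^sub>m (S * S) + w \<cdot>\<^sub>m S = 0\<^sub>m 3 3"
    proof -
      have "t * (N * t) = 1\<^sub>m 3 + (w * w) \<cdot>\<^sub>m (S * S) + w \<cdot>\<^sub>m S"
        using S t by (simp add: N_def mat3_ring_simps tS' tt SSS' assoc_add_mat[of _ 3 3])
      moreover have "t * (N * t) = 0\<^sub>m 3 3" using t by (simp add: N0)
      ultimately show ?thesis by simp
    qed
    have "S = S * S"
    proof (rule mat3_eqI)
      fix i j :: nat assume ij: "i < 3" "j < 3"
      define d p q where "d = (1\<^sub>m 3 :: complex mat) $$ (i, j)" and "p = S $$ (i, j)"
        and "q = (S * S) $$ (i, j)"
      have "N $$ (i, j) = 0" using ij by (simp add: N0)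
      then have 1: "d + w * w * p + w * q = 0"
        using ij S by (simp add: N_def d_def p_def q_def del: index_mult_mat(1) index_one_mat(1))
      have "(1\<^sub>m 3 + (w * w) \<cdot>\<^sub>m (S * S) + w \<cdot>\<^sub>m S) $$ (i, j) = 0" using ij by (simp add: N0')
      then have 2: "d + w * w * q + w * p = 0"
        using ij S by (simp add: d_def p_def q_def del: index_mult_mat(1) index_one_mat(1))
      have "(w - w * w) * (p - q) = (d + w * w * q + w * p) - (d + w * w * p + w * q)"
        by (simp add: algebra_simps)
      then have "(w - w * w) * (p - q) = 0" by (simp only: 1 2) simp
      then show "S $$ (i, j) = (S * S) $$ (i, j)" using w_neq(3) by (simp add: p_def q_def del: index_mult_mat(1))
    qed (use S in auto)
    then have "S * (S * S) = S" by metis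
    then show False using SSS S1 by simp
  qed
  then obtain i k where ik: "i < 3" "k < 3" "N $$ (i, k) \<noteq> 0"
    using mat3_eqI[OF N, of "0\<^sub>m 3 3"] by auto
  define u1 where "u1 = col N k"
  define u2 where "u2 = t *\<^sub>v u1"
  have u1: "u1 \<in> carrier_vec 3" using N ik by (simp add: u1_def)
  have u2: "u2 \<in> carrier_vec 3" using t u1 by (simp add: u2_def)
  have "u1 $ i \<noteq> 0" using N ik by (simp add: u1_def)
  then have u1_nz: "u1 \<noteq> 0\<^sub>v 3" using ik by auto
  have tu2: "t *\<^sub>v u2 = u1"
    unfolding u2_def using t u1 by (simp flip: assoc_mult_mat_vec add: tt)
  have u2_nz: "u2 \<noteq> 0\<^sub>v 3"
  proof
    assume "u2 = 0\<^sub>v 3"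
    moreover have "t *\<^sub>v 0\<^sub>v 3 = 0\<^sub>v 3" using t by simp
    ultimately show False using tu2 u1_nz by simp
  qed
  have Su1: "S *\<^sub>v u1 = w \<cdot>\<^sub>v u1"
  proof -
    have "S *\<^sub>v u1 = col (S * N) k" unfolding u1_def by (rule col_mult2[OF S N ik(2), symmetric])
    also have "\<dots> = w \<cdot>\<^sub>v u1" using N ik by (simp add: SN u1_def)
    finally show ?thesis .
  qed
  have Su2: "S *\<^sub>v u2 = (w * w) \<cdot>\<^sub>v u2"
  proof -
    have "S *\<^sub>v u2 = (S * t) *\<^sub>v u1"
      unfolding u2_def using S t u1 by (simp add: assoc_mult_mat_vec[of _ 3 3 _ 3])
    also have "\<dots> = t *\<^sub>v (S *\<^sub>v (S *\<^sub>v u1))"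
      unfolding St using S t u1 by (simp add: assoc_mult_mat_vec[of _ 3 3 _ 3])
    also have "\<dots> = (w * w) \<cdot>\<^sub>v u2"
      using S t u1 by (simp add: Su1 mult_mat_vec[of _ 3 3] u2_def smult_smult_assoc)
    finally show ?thesis .
  qed
  define P where "P = mat 3 3 (\<lambda>(i, j). ([u0, u1, u2] ! j) $ i)"
  have P: "P \<in> carrier_mat 3 3" by (simp add: P_def)
  have colP: "col P 0 = u0" "col P (Suc 0) = u1" "col P 2 = u2"
    using u0 u1 u2 by (auto simp: P_def)
  have Pi: "P $$ (i, 0) = u0 $ i" "P $$ (i, Suc 0) = u1 $ i" "P $$ (i, 2) = u2 $ i"
    if "i < 3" for i
    using that by (simp_all add: P_def)
  have prod_col: "(X * P) $$ (i, j) = (X *\<^sub>v col P j) $ i"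
    if "i < 3" "j < 3" "X \<in> carrier_mat 3 3" for X i j
    using that P by simp
  have SP: "S * P = P * diag3 1 w (w * w)"
  proof (rule mat3_eqI)
    fix i j :: nat assume ij: "i < 3" "j < 3"
    have "(P * diag3 1 w (w * w)) $$ (i, j) = P $$ (i, j) * [1, w, w * w] ! j"
      using ij P unfolding less3_cases[of j]
      by (elim disjE; simp add: mult_mat3_index del: index_mult_mat(1))
    moreover have "(S * P) $$ (i, j) = P $$ (i, j) * [1, w, w * w] ! j"
      using ij S u0 u1 u2 unfolding prod_col[OF ij S] less3_cases[of j]
      by (elim disjE; simp add: colP Su1 Su2 Pi)
    ultimately show "(S * P) $$ (i, j) = (P * diag3 1 w (w * w)) $$ (i, j)" by simp
  qed (use S P in auto)
  have "det P \<noteq> 0"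
  proof
    assume "det P = 0"
    then obtain z where z: "z \<in> carrier_vec 3" "z \<noteq> 0\<^sub>v 3" "P *\<^sub>v z = 0\<^sub>v 3"
      using det_0_iff_vec_prod_zero[OF P] by auto
    let ?D = "diag3 1 w (w * w)"
    have PD: "P *\<^sub>v (?D *\<^sub>v v) = S *\<^sub>v (P *\<^sub>v v)" if "v \<in> carrier_vec 3" for v
      using assoc_mult_mat_vec[of P 3 3 ?D 3 v] assoc_mult_mat_vec[of S 3 3 P 3 v] that P S SP by simp
    have PDz: "P *\<^sub>v (?D *\<^sub>v z) = 0\<^sub>v 3" "P *\<^sub>v (?D *\<^sub>v (?D *\<^sub>v z)) = 0\<^sub>v 3"
      using z S mult_mat_vec_carrier[of ?D 3 3 z] by (simp_all add: PD)
    have ex: "(P *\<^sub>v v) $ i = u0 $ i * v $ 0 + u1 $ i * v $ Suc 0 + u2 $ i * v $ 2"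
      if "i < 3" "v \<in> carrier_vec 3" for v i
      using that P by (auto simp: scalar_prod_def eval_nat_numeral P_def)
    have D: "(?D *\<^sub>v v) $ 0 = v $ 0" "(?D *\<^sub>v v) $ Suc 0 = w * v $ Suc 0"
      "(?D *\<^sub>v v) $ 2 = w * w * v $ 2" if "v \<in> carrier_vec 3" for v
      using that by (auto simp: scalar_prod_def eval_nat_numeral diag3_def)
    have Dc: "?D *\<^sub>v v \<in> carrier_vec 3" if "v \<in> carrier_vec 3" for v
      using that by (intro mult_mat_vec_carrier) auto
    have eqs: "u0 $ i * z $ 0 = 0 \<and> u1 $ i * z $ Suc 0 = 0 \<and> u2 $ i * z $ 2 = 0"
      if "i < 3" for i
    proof -
      define p q r where "p = u0 $ i * z $ 0" and "q = u1 $ i * z $ Suc 0" and "r = u2 $ i * z $ 2"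
      have 1: "p + q + r = 0"
        using ex[OF that z(1)] z(3) that by (simp add: p_def q_def r_def)
      have 2: "p + w * q + w * w * r = 0"
        using ex[OF that Dc[OF z(1)]] PDz(1) that z(1) by (simp add: p_def q_def r_def D algebra_simps del: index_mult_mat_vec)
      have 3: "p + w * w * q + w * r = 0"
        using ex[OF that Dc[OF Dc[OF z(1)]]] PDz(2) that z(1)
        by (simp add: p_def q_def r_def D Dc del: index_mult_mat_vec) (simp add: algebra_simps w w')
      \<comment> \<open>The kernel of \<open>P\<close> is stable under \<open>?D\<close>, which
        gives one equation for each power of \<open>?D\<close>; Fourier inversion over the cube
        roots of unity separates the three summands.\<close>
      have "3 * p = (p + q + r) + (p + w * q + w * w * r) + (p + w * w * q + w * r)"
        "3 * q = (p + q + r) + w * w * (p + w * q + w * w * r) + w * (p + w * w * q + w * r)"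
        "3 * r = (p + q + r) + w * (p + w * q + w * w * r) + w * w * (p + w * w * q + w * r)"
        by (simp_all add: algebra_simps w w')
      then have "3 * p = 0" "3 * q = 0" "3 * r = 0"
        by (simp_all only: 1 2 3) simp_all
      then show ?thesis by (simp add: p_def q_def r_def)
    qed
    have nz: "c = 0" if u: "u \<in> carrier_vec 3" "u \<noteq> 0\<^sub>v 3" and uc: "\<And>i. i < 3 \<Longrightarrow> u $ i * c = 0"
      for u :: "complex vec" and c
    proof -
      have "\<exists>i<3. u $ i \<noteq> 0"
      proof (rule ccontr)
        assume "\<not> ?thesis"
        then have "u = 0\<^sub>v 3" using u(1) by (intro eq_vecI) auto
        then show False using u(2) by simp
      qed
      then obtain i where "i < 3" "u $ i \<noteq> 0" by blast
      then show ?thesis using uc[of i] by simp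
    qed
    have "z $ 0 = 0" by (rule nz[OF u0(1,2)]) (simp only: eqs)
    moreover have "z $ Suc 0 = 0" by (rule nz[OF u1 u1_nz]) (simp only: eqs)
    moreover have "z $ 2 = 0" by (rule nz[OF u2 u2_nz]) (simp only: eqs)
    ultimately have "z $ i = 0" if "i < 3" for i using that by (auto simp: less3_cases)
    then have "z = 0\<^sub>v 3" using z(1) by (intro eq_vecI) auto
    then show False using z(2) by simp
  qed
  from det_non_zero_imp_unit[OF P this, of "()"]
  obtain Q where Q: "Q \<in> carrier_mat 3 3" "Q * P = 1\<^sub>m 3" "P * Q = 1\<^sub>m 3"
    by (auto simp: Units_def ring_mat_simps)
  define D where "D = diag3 1 w (w * w)"
  have D: "D \<in> carrier_mat 3 3" by (simp add: D_def)
  have PQ': "P * (Q * X) = X" if "X \<in> carrier_mat 3 3" for X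
    using assoc3[of P Q X] P Q that by simp
  have QP': "Q * (P * X) = X" if "X \<in> carrier_mat 3 3" for X
    using assoc3[of Q P X] P Q that by simp
  have QSP: "Q * S * P = D"
    using S P Q D by (simp add: assoc3 SP QP' flip: D_def)
  define t' where "t' = Q * t * P"
  have t': "t' \<in> carrier_mat 3 3" using t P Q by (simp add: t'_def)
  have t't': "t' * t' = 1\<^sub>m 3"
    using t P Q by (simp add: t'_def assoc3 PQ' tt')
  have t'D: "t' * D = D * (D * t')"
    using S t P Q by (simp add: t'_def assoc3 PQ' tS' flip: QSP)
  \<comment> \<open>An entry of \<open>t'\<close> can be nonzero only where the \<open>j\<close>-th
    eigenvalue is the square of the \<open>i\<close>-th.\<close>
  have sqrt1: "t' $$ (i, j) * D $$ (j, j) = D $$ (i, i) * (D $$ (i, i) * t' $$ (i, j))"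
    if "i < 3" "j < 3" for i j
    using arg_cong[OF t'D, of "\<lambda>M. M $$ (i, j)"] that t' D unfolding less3_cases
    by (elim disjE; simp add: D_def mult_mat3_index del: index_mult_mat(1))
  have z: "t' $$ (0, Suc 0) = 0" "t' $$ (0, 2) = 0" "t' $$ (Suc 0, 0) = 0" "t' $$ (2, 0) = 0"
     "t' $$ (Suc 0, Suc 0) = 0" "t' $$ (2, 2) = 0"
    using sqrt1[of 0 "Suc 0"] sqrt1[of 0 2] sqrt1[of "Suc 0" 0] sqrt1[of 2 0]
      sqrt1[of "Suc 0" "Suc 0"] sqrt1[of 2 2] w_neq
    by (auto simp: D_def)
  have tP: "(t * P) $$ (i, Suc 0) = P $$ (i, 2)" if "i < 3" for i
    using that t unfolding prod_col[OF that _ t] by (simp add: prod_col colP Pi flip: u2_def)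
  \<comment> \<open>Taking \<open>u2 = t u1\<close> normalizes this entry to 1, and
    \<open>t' * t' = 1\<close> then fixes the opposite one.\<close>
  have "t' $$ (2, Suc 0) = (Q * (t * P)) $$ (2, Suc 0)"
    using t P Q by (simp add: t'_def assoc3)
  also have "\<dots> = (Q * P) $$ (2, 2)"
    using t P Q(1) by (simp add: mult_mat3_index[of Q] tP del: index_mult_mat(1))
  finally have t21: "t' $$ (2, Suc 0) = 1" using Q by simp
  have "t' $$ (Suc 0, 2) = 1"
    using arg_cong[OF t't', of "\<lambda>M. M $$ (Suc 0, Suc 0)"] t'
    by (simp add: mult_mat3_index z t21 del: index_mult_mat(1))
  then have sw: "t' = swap3 (t' $$ (0, 0))"
    using t' z t21 by (intro mat3_eqI) (auto simp: less3_cases)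
  moreover have "t' $$ (0, 0) * t' $$ (0, 0) = 1"
    using arg_cong[OF t't', of "\<lambda>M. M $$ (0, 0)"] t'
    by (simp add: mult_mat3_index z del: index_mult_mat(1))
  ultimately show ?thesis
    using that[of P Q "t' $$ (0, 0)"] P Q QSP unfolding D_def t'_def by simp
qed

text \<open>The eigenvalues are distinct, so \<open>E\<close> is diagonal; the coefficients are the
  inverse discrete Fourier transform of its diagonal.\<close>

lemma commute_diag3:
  fixes E :: "complex mat"
  assumes E: "E \<in> carrier_mat 3 3" and w: "w * w = - 1 - w"
    and comm: "E * diag3 1 w (w * w) = diag3 1 w (w * w) * E"
  shows "\<exists>a b c. E = a \<cdot>\<^sub>m 1\<^sub>m 3 + b \<cdot>\<^sub>m diag3 1 w (w * w) + c \<cdot>\<^sub>m (diag3 1 w (w * w) * diag3 1 w (w * w))"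
proof -
  let ?D = "diag3 1 w (w * w)"
  note w_neq = cube_root_of_unity_neq[OF w]
  have w': "w * (w * x) = - x - w * x" for x
    using arg_cong[OF w, of "\<lambda>y. y * x"] by (simp add: algebra_simps)
  have off: "E $$ (i, j) * ?D $$ (j, j) = ?D $$ (i, i) * E $$ (i, j)" if "i < 3" "j < 3" for i j
    using arg_cong[OF comm, of "\<lambda>M. M $$ (i, j)"] that E unfolding less3_cases
    by (elim disjE; simp add: mult_mat3_index del: index_mult_mat(1))
  have z: "E $$ (0, Suc 0) = 0" "E $$ (0, 2) = 0" "E $$ (Suc 0, 0) = 0" "E $$ (2, 0) = 0"
     "E $$ (Suc 0, 2) = 0" "E $$ (2, Suc 0) = 0"
    using off[of 0 "Suc 0"] off[of 0 2] off[of "Suc 0" 0] off[of 2 0]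
      off[of "Suc 0" 2] off[of 2 "Suc 0"] w_neq
    by auto
  define p q r where "p = E $$ (0, 0)" and "q = E $$ (Suc 0, Suc 0)" and "r = E $$ (2, 2)"
  have "E = ((p + q + r) / 3) \<cdot>\<^sub>m 1\<^sub>m 3 + ((p + w * w * q + w * r) / 3) \<cdot>\<^sub>m ?D
     + ((p + w * q + w * w * r) / 3) \<cdot>\<^sub>m (?D * ?D)" (is "E = ?R")
  proof (rule mat3_eqI)
    have e: "3 * q = p + q + r + (p + w * w * q + w * r) * w + (p + w * q + w * w * r) * (w * w)"
      "3 * r = p + q + r + (p + w * w * q + w * r) * (w * w) + (p + w * q + w * w * r) * (w * w * (w * w))"
      by (simp_all add: algebra_simps w w')
    have 0: "?R $$ (0, 0) = p"
      by (simp add: mult_mat3_index w del: index_mult_mat(1)) (simp add: field_simps)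
    have "?R $$ (Suc 0, Suc 0) = (p + q + r + (p + w * w * q + w * r) * w + (p + w * q + w * w * r) * (w * w)) / 3"
      by (simp add: mult_mat3_index add_divide_distrib distrib_right del: index_mult_mat(1))
    then have 1: "?R $$ (Suc 0, Suc 0) = q" by (simp only: e(1)[symmetric]) simp
    have "?R $$ (2, 2) = (p + q + r + (p + w * w * q + w * r) * (w * w) + (p + w * q + w * w * r) * (w * w * (w * w))) / 3"
      by (simp add: mult_mat3_index add_divide_distrib distrib_right del: index_mult_mat(1))
    then have 2: "?R $$ (2, 2) = r" by (simp only: e(2)[symmetric]) simp
    fix i j :: nat assume "i < 3" "j < 3"
    then show "E $$ (i, j) = ?R $$ (i, j)"
      unfolding less3_cases
      by (elim disjE; simp only: 0 1 2 z p_def[symmetric] q_def[symmetric] r_def[symmetric])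
        (simp_all add: mult_mat3_index del: index_mult_mat(1))
  qed (use E in simp_all)
  then show ?thesis by blast
qed


text \<open>Here \<open>N\<close> is a column \<open>v\<close> times a row \<open>p\<close>, so
  \<open>N X N\<close> is \<open>N\<close> multiplied by the number \<open>p X v\<close>, which is
  the long sum.\<close>

lemma rank_one_sandwich:
  fixes v p :: "nat \<Rightarrow> complex"
  assumes X: "X \<in> carrier_mat 3 3" and ij: "i < 3" "j < 3"
  defines "N \<equiv> mat 3 3 (\<lambda>(i, j). v i * p j)"
  shows "(N * X * N) $$ (i, j) = v i * p j *
    (p 0 * X $$ (0, 0) * v 0 + p 0 * X $$ (0, Suc 0) * v (Suc 0) + p 0 * X $$ (0, 2) * v 2
     + p (Suc 0) * X $$ (Suc 0, 0) * v 0 + p (Suc 0) * X $$ (Suc 0, Suc 0) * v (Suc 0)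
     + p (Suc 0) * X $$ (Suc 0, 2) * v 2
     + p 2 * X $$ (2, 0) * v 0 + p 2 * X $$ (2, Suc 0) * v (Suc 0) + p 2 * X $$ (2, 2) * v 2)"
proof -
  have N: "N \<in> carrier_mat 3 3" by (simp add: N_def)
  have Ni: "N $$ (i, j) = v i * p j" if "i < 3" "j < 3" for i j using that by (simp add: N_def)
  show ?thesis
    using X N ij by (simp add: mult_mat3_index Ni del: index_mult_mat(1)) (simp add: algebra_simps)
qed

text \<open>In the coordinates where \<open>S\<close> and \<open>t\<close> are standard, the matrix \<open>T\<close> commuting with \<open>t\<close> and with
  its conjugate under \<open>S\<close> is, unless it is diagonal, a scalar plus a matrix of rank one. If the
  latter is not supported on an eigenspace of \<open>S\<close> then its three conjugates under the powers of \<open>S\<close>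
  annihilate each other and add up to a scalar, which allows the trace of \<open>A\<close> to be computed.\<close>

lemma commutant_rank_one_trace:
  fixes A N S T :: "complex mat" and v p :: "nat \<Rightarrow> complex"
  assumes A: "A \<in> carrier_mat 3 3" and A': "A' \<in> carrier_mat 3 3" and A'A: "A' * A = 1\<^sub>m 3"
    and T: "T \<in> carrier_mat 3 3"
    and w: "w * w = - 1 - w"
    and S: "S = diag3 1 w (w * w)"
    and N: "N = mat 3 3 (\<lambda>(i, j). v i * p j)"
    and vp: "v 0 * p 0 = g" "v (Suc 0) * p (Suc 0) = g" "v 2 * p 2 = g" and g: "g \<noteq> 0"
    and NA: "N * A = A * N"
    and TN: "T * N = r \<cdot>\<^sub>m N" and NT: "N * T = r \<cdot>\<^sub>m N"
    and STS: "S * T * S = A * S * A"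
  shows "eigenvalue A (A $$ (0, 0) + A $$ (Suc 0, Suc 0) + A $$ (2, 2))"
proof -
  have w': "w * (w * x) = - x - w * x" for x
    using arg_cong[OF w, of "\<lambda>y. y * x"] by (simp add: algebra_simps)
  have Nc: "N \<in> carrier_mat 3 3" by (simp add: N)
  have Sc: "S \<in> carrier_mat 3 3" by (simp add: S)
  note c = A A' T Nc Sc
  have Ni: "N $$ (i, j) = v i * p j" if "i < 3" "j < 3" for i j using that by (simp add: N)
  have p1: "p (Suc 0) \<noteq> 0" "v (Suc 0) \<noteq> 0" using vp g by auto
  define u where "u i = A $$ (i, 0) * v 0 + A $$ (i, Suc 0) * v (Suc 0) + A $$ (i, 2) * v 2" for i
  define s where "s = p 0 * A $$ (0, Suc 0) + p (Suc 0) * A $$ (Suc 0, Suc 0) + p 2 * A $$ (2, Suc 0)"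
  define x where "x = s / p (Suc 0)"
  \<comment> \<open>\<open>A\<close> commutes with \<open>N\<close>, hence preserves its range, the
    line of \<open>v\<close>. The eigenvalue \<open>x\<close> is read off in column 1, where
    \<open>p\<close> does not vanish.\<close>
  have uv: "u i = x * v i" if "i < 3" for i
  proof -
    have "(N * A) $$ (i, Suc 0) = v i * s"
      using that c by (simp add: mult_mat3_index Ni s_def algebra_simps del: index_mult_mat(1))
    moreover have "(A * N) $$ (i, Suc 0) = u i * p (Suc 0)"
      using that c by (simp add: mult_mat3_index Ni u_def algebra_simps del: index_mult_mat(1))
    ultimately show ?thesis using NA p1 by (simp add: x_def field_simps)
  qed
  have AN: "A * N = x \<cdot>\<^sub>m N"
  proof (rule mat3_eqI)
    fix i j :: nat assume ij: "i < 3" "j < 3"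
    have "(A * N) $$ (i, j) = u i * p j"
      using ij c by (simp add: mult_mat3_index Ni u_def algebra_simps del: index_mult_mat(1))
    then show "(A * N) $$ (i, j) = (x \<cdot>\<^sub>m N) $$ (i, j)"
      using ij c by (simp add: uv Ni del: index_mult_mat(1))
  qed (use c in auto)
  have N1: "N $$ (Suc 0, Suc 0) \<noteq> 0" by (simp add: Ni vp g)
  have x0: "x \<noteq> 0"
  proof
    assume "x = 0"
    then have "A * N = 0\<^sub>m 3 3" using AN c by (auto intro!: mat3_eqI)
    then have "A' * A * N = 0\<^sub>m 3 3" using c by (simp add: assoc3)
    then have "N = 0\<^sub>m 3 3" using c by (simp add: A'A)
    then show False using N1 by simp
  qed
  have ev: "eigenvalue A x"
    unfolding eigenvalue_def eigenvector_def
  proof (intro exI conjI)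
    show "col N (Suc 0) \<in> carrier_vec (dim_row A)" using c by (intro carrier_vecI) simp
    show "col N (Suc 0) \<noteq> 0\<^sub>v (dim_row A)"
    proof
      assume "col N (Suc 0) = 0\<^sub>v (dim_row A)"
      then have "col N (Suc 0) $ Suc 0 = 0" using A by (simp del: index_col)
      then show False using N1 c by simp
    qed
    have "A *\<^sub>v col N (Suc 0) = col (A * N) (Suc 0)" by (rule col_mult2[OF A Nc, symmetric]) simp
    also have "\<dots> = x \<cdot>\<^sub>v col N (Suc 0)" using c by (simp add: AN)
    finally show "A *\<^sub>v col N (Suc 0) = x \<cdot>\<^sub>v col N (Suc 0)" .
  qed
  have SSS: "S * (S * S) = 1\<^sub>m 3"
    by (rule mat3_eqI)
      (auto simp: S less3_cases mult_mat3_index w w' algebra_simps simp del: index_mult_mat(1))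
  have SSS': "S * (S * (S * X)) = X" if "X \<in> carrier_mat 3 3" for X
  proof -
    have "S * (S * (S * X)) = (S * (S * S)) * X" using Sc that by (simp add: assoc3)
    then show ?thesis using that by (simp add: SSS)
  qed
  have pre: "X * (Y * Z) = W * Z" if "X * Y = W" "X \<in> carrier_mat 3 3" "Y \<in> carrier_mat 3 3" "Z \<in> carrier_mat 3 3"
    for W X Y Z :: "complex mat" using that by (simp flip: assoc3)
  \<comment> \<open>All products \<open>v i * p i\<close> equal \<open>g\<close>, so the scalar
    \<open>p S v\<close> is \<open>g (1 + w + w^2) = 0\<close>.\<close>
  have NSN: "N * S * N = 0\<^sub>m 3 3"
  proof (rule mat3_eqI)
    fix i j :: nat assume ij: "i < 3" "j < 3"
    have "p 0 * v 0 + p (Suc 0) * w * v (Suc 0) + p 2 * (w * w) * v 2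
      = v 0 * p 0 + w * (v (Suc 0) * p (Suc 0)) + w * w * (v 2 * p 2)" by (simp add: algebra_simps)
    also have "\<dots> = 0" by (simp only: vp) (simp add: w algebra_simps)
    finally show "(N * S * N) $$ (i, j) = 0\<^sub>m 3 3 $$ (i, j)"
      using rank_one_sandwich[OF Sc ij, of v p, folded N] ij by (simp add: S algebra_simps)
  qed (use c in auto)
  have ASA: "A * (S * (A * X)) = S * (T * (S * X))" if "X \<in> carrier_mat 3 3" for X
  proof -
    have "A * (S * (A * X)) = (A * S * A) * X" using c that by (simp add: assoc3)
    also have "\<dots> = S * (T * (S * X))" using c that by (simp add: assoc3 flip: STS)
    finally show ?thesis .
  qed
  have smult_zero: "X = 0\<^sub>m 3 3" if "x \<cdot>\<^sub>m X = 0\<^sub>m 3 3" "X \<in> carrier_mat 3 3" for X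
  proof (rule mat3_eqI)
    fix i j :: nat assume ij: "i < 3" "j < 3"
    then have "(x \<cdot>\<^sub>m X) $$ (i, j) = 0" by (simp add: that(1))
    moreover have "(x \<cdot>\<^sub>m X) $$ (i, j) = x * X $$ (i, j)" using ij that(2) by simp
    ultimately show "X $$ (i, j) = 0\<^sub>m 3 3 $$ (i, j)" using ij x0 by simp
  qed (use that in auto)
  \<comment> \<open>The nonzero factor \<open>x\<close> is traded for a factor \<open>A\<close> next
    to \<open>N\<close>, creating \<open>A S A = S T S\<close>; what is left is a multiple of
    \<open>N S N\<close>.\<close>
  have "N * (S * (A * (S * S))) * N = 0\<^sub>m 3 3"
  proof (rule smult_zero)
    have "x \<cdot>\<^sub>m (N * (S * (A * (S * S))) * N) = (x \<cdot>\<^sub>m N) * (S * (A * (S * (S * N))))"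
      using c by (simp add: mat3_ring_simps)
    also have "\<dots> = N * (A * (S * (A * (S * (S * N)))))"
      using c by (simp add: assoc3 flip: AN NA)
    also have "\<dots> = (N * S) * (T * N)" using c by (simp add: ASA SSS' assoc3)
    also have "\<dots> = r \<cdot>\<^sub>m (N * S * N)" using c by (simp add: TN mat3_ring_simps)
    finally show "x \<cdot>\<^sub>m (N * (S * (A * (S * S))) * N) = 0\<^sub>m 3 3" by (auto simp: NSN intro!: mat3_eqI)
  qed (use c in simp)
  note E1 = this
  have "N * (S * (S * (A * S))) * N = 0\<^sub>m 3 3"
  proof (rule smult_zero)
    have "x \<cdot>\<^sub>m (N * (S * (S * (A * S))) * N) = N * (S * (S * (A * (S * (x \<cdot>\<^sub>m N)))))"
      using c by (simp add: mat3_ring_simps)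
    also have "\<dots> = N * (S * (S * (A * (S * (A * N)))))" by (simp only: AN)
    also have "\<dots> = (N * T) * (S * N)" using c by (simp add: ASA SSS' assoc3)
    also have "\<dots> = r \<cdot>\<^sub>m (N * S * N)" using c by (simp add: NT mat3_ring_simps)
    finally show "x \<cdot>\<^sub>m (N * (S * (S * (A * S))) * N) = 0\<^sub>m 3 3" by (auto simp: NSN intro!: mat3_eqI)
  qed (use c in simp)
  note E2 = this
  define a where "a i j = p i * A $$ (i, j) * v j" for i j
  have e0: "a 0 0 + a 0 (Suc 0) + a 0 2 + a (Suc 0) 0 + a (Suc 0) (Suc 0) + a (Suc 0) 2
      + a 2 0 + a 2 (Suc 0) + a 2 2 = 3 * g * x"
  proof -
    have "a 0 0 + a 0 (Suc 0) + a 0 2 + a (Suc 0) 0 + a (Suc 0) (Suc 0) + a (Suc 0) 2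
      + a 2 0 + a 2 (Suc 0) + a 2 2 = p 0 * u 0 + p (Suc 0) * u (Suc 0) + p 2 * u 2"
      by (simp add: a_def u_def algebra_simps)
    also have "\<dots> = x * (v 0 * p 0) + x * (v (Suc 0) * p (Suc 0)) + x * (v 2 * p 2)"
      by (simp add: uv)
    finally show ?thesis by (simp add: vp)
  qed
  have entry: "p 0 * X $$ (0, 0) * v 0 + p 0 * X $$ (0, Suc 0) * v (Suc 0) + p 0 * X $$ (0, 2) * v 2
     + p (Suc 0) * X $$ (Suc 0, 0) * v 0 + p (Suc 0) * X $$ (Suc 0, Suc 0) * v (Suc 0)
     + p (Suc 0) * X $$ (Suc 0, 2) * v 2
     + p 2 * X $$ (2, 0) * v 0 + p 2 * X $$ (2, Suc 0) * v (Suc 0) + p 2 * X $$ (2, 2) * v 2 = 0"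
    if "N * X * N = 0\<^sub>m 3 3" "X \<in> carrier_mat 3 3" for X
    using rank_one_sandwich[OF that(2), of "Suc 0" "Suc 0" v p, folded N] p1 by (simp add: that(1))
  have e1: "a 0 0 + w * w * a 0 (Suc 0) + w * a 0 2 + w * a (Suc 0) 0 + a (Suc 0) (Suc 0)
      + w * w * a (Suc 0) 2 + w * w * a 2 0 + w * a 2 (Suc 0) + a 2 2 = 0"
    using entry[OF E1] A
    by (simp add: mult_mat3_index S del: index_mult_mat(1)) (simp add: a_def algebra_simps w w')
  have e2: "a 0 0 + w * a 0 (Suc 0) + w * w * a 0 2 + w * w * a (Suc 0) 0 + a (Suc 0) (Suc 0)
      + w * a (Suc 0) 2 + w * a 2 0 + w * w * a 2 (Suc 0) + a 2 2 = 0"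
    using entry[OF E2] A
    by (simp add: mult_mat3_index S del: index_mult_mat(1)) (simp add: a_def algebra_simps w w')
  \<comment> \<open>Adding \<open>p X v\<close> over the three conjugates \<open>X\<close> of
    \<open>A\<close> by powers of \<open>S\<close> cancels the off-diagonal terms. Only the
    unconjugated one contributes, so the trace of \<open>A\<close> is \<open>x\<close>.\<close>
  have "3 * (a 0 0 + a (Suc 0) (Suc 0) + a 2 2) =
     (a 0 0 + a 0 (Suc 0) + a 0 2 + a (Suc 0) 0 + a (Suc 0) (Suc 0) + a (Suc 0) 2
      + a 2 0 + a 2 (Suc 0) + a 2 2)
   + (a 0 0 + w * w * a 0 (Suc 0) + w * a 0 2 + w * a (Suc 0) 0 + a (Suc 0) (Suc 0)
      + w * w * a (Suc 0) 2 + w * w * a 2 0 + w * a 2 (Suc 0) + a 2 2)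
   + (a 0 0 + w * a 0 (Suc 0) + w * w * a 0 2 + w * w * a (Suc 0) 0 + a (Suc 0) (Suc 0)
      + w * a (Suc 0) 2 + w * a 2 0 + w * w * a 2 (Suc 0) + a 2 2)"
    by (simp add: algebra_simps w w')
  also have "\<dots> = 3 * g * x" by (simp only: e0 e1 e2) simp
  finally have "3 * (a 0 0 + a (Suc 0) (Suc 0) + a 2 2) = 3 * (g * x)" by (simp only: mult.assoc)
  then have "a 0 0 + a (Suc 0) (Suc 0) + a 2 2 = g * x"
    by (metis mult_left_cancel zero_neq_numeral)
  moreover have "a i i = A $$ (i, i) * (v i * p i)" for i by (simp add: a_def)
  ultimately have "g * (A $$ (0, 0) + A $$ (Suc 0, Suc 0) + A $$ (2, 2)) = g * x"
    by (simp add: vp distrib_left mult.commute[of g])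
  then show ?thesis using g ev by simp
qed

text \<open>Commuting with \<open>t\<close> leaves five parameters of \<open>T\<close>, and
  commuting with \<open>S T S^-1\<close> adds \<open>b (a - d) = c (a - d) = 0\<close> and
  \<open>b c = f^2\<close>. If \<open>f = 0\<close> then \<open>b\<close> or \<open>c\<close>
  vanishes and irreducibility decides; otherwise \<open>T\<close> is a scalar plus a matrix of rank
  one.\<close>

lemma diagonal_commutant_scalar_or_trace:
  fixes A A' S T t :: "complex mat"
  assumes irr: "irreducible3 {A, S, t}"
    and A: "A \<in> carrier_mat 3 3" and A': "A' \<in> carrier_mat 3 3" and A'A: "A' * A = 1\<^sub>m 3"
    and T: "T \<in> carrier_mat 3 3"
    and w: "w * w = - 1 - w" and e: "e * e = 1"
    and S: "S = diag3 1 w (w * w)" and t: "t = swap3 e"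
    and TA: "T * A = A * T" and Tt: "T * t = t * T"
    and TU: "T * (S * T * (S * S)) = S * T * (S * S) * T"
    and STS: "S * T * S = A * S * A"
  shows "(\<exists>k. T = k \<cdot>\<^sub>m 1\<^sub>m 3) \<or> eigenvalue A (A $$ (0, 0) + A $$ (Suc 0, Suc 0) + A $$ (2, 2))"
proof -
  note w_neq = cube_root_of_unity_neq[OF w]
  have w': "w * (w * x) = - x - w * x" for x
    using arg_cong[OF w, of "\<lambda>y. y * x"] by (simp add: algebra_simps)
  have e': "e * (e * x) = x" for x using e by (simp flip: mult.assoc)
  have Sc: "S \<in> carrier_mat 3 3" and tc: "t \<in> carrier_mat 3 3" by (simp_all add: S t)
  define a b c d f where "a = T $$ (0, 0)" and "b = T $$ (0, Suc 0)" and "c = T $$ (Suc 0, 0)"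
    and "d = T $$ (Suc 0, Suc 0)" and "f = T $$ (Suc 0, 2)"
  have Tt_index: "(T * t) $$ (i, j) = (t * T) $$ (i, j)" for i j by (simp only: Tt)
  have Ti: "T $$ (0, 0) = a" "T $$ (0, Suc 0) = b" "T $$ (Suc 0, 0) = c"
      "T $$ (Suc 0, Suc 0) = d" "T $$ (Suc 0, 2) = f"
      "T $$ (0, 2) = e * b" "T $$ (2, 0) = e * c" "T $$ (2, 2) = d" "T $$ (2, Suc 0) = f"
    using Tt_index[of 0 "Suc 0"] Tt_index[of "Suc 0" 0] Tt_index[of "Suc 0" "Suc 0"]
      Tt_index[of "Suc 0" 2] T
    by (simp_all add: a_def b_def c_def d_def f_def t mult_mat3_index e' mult.commute
        del: index_mult_mat(1))
  have TU_index: "(T * (S * T * (S * S))) $$ (i, j) = (S * T * (S * S) * T) $$ (i, j)" for i j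
    by (simp only: TU)
  have bad: "b * (a - d) = 0" and cad: "c * (a - d) = 0" and bcf: "b * c = f * f"
  proof -
    have "w * w * b * a - w * w * b * d - b * a + b * d = 0"
      using TU_index[of 0 "Suc 0"] T
      by (simp add: S mult_mat3_index Ti del: index_mult_mat(1)) (simp add: algebra_simps w w' e e')
    then have "(w * w - 1) * (b * (a - d)) = 0" by (simp only: algebra_simps mult_1_left add_0_left)
    then show "b * (a - d) = 0" using w_neq(4) by simp
    have "w * c * a - w * c * d - c * a + c * d = 0"
      using TU_index[of "Suc 0" 0] T
      by (simp add: S mult_mat3_index Ti del: index_mult_mat(1)) (simp add: algebra_simps w w' e e')
    then have "(w - 1) * (c * (a - d)) = 0" by (simp only: algebra_simps mult_1_left add_0_left)
    then show "c * (a - d) = 0" using w_neq by simp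
    have "w * b * c - w * f * f - w * w * b * c + w * w * f * f = 0"
      using TU_index[of "Suc 0" "Suc 0"] T
      by (simp add: S mult_mat3_index Ti del: index_mult_mat(1)) (simp add: algebra_simps w w' e e')
    then have "(w - w * w) * (b * c - f * f) = 0" by (simp only: algebra_simps mult_1_left add_0_left)
    then show "b * c = f * f" using w_neq(3) by simp
  qed
  have TA_index: "(T * A) $$ (i, j) = (A * T) $$ (i, j)" for i j by (simp only: TA)
  consider "b = 0" "c = 0" "f = 0" | "b \<noteq> 0" "c = 0" "f = 0" | "b = 0" "c \<noteq> 0" "f = 0"
    | "f \<noteq> 0" using bcf by force
  then show ?thesis
  proof cases
    case 1
    have Td: "T = diag3 a d d"
      using T Ti 1 by (intro mat3_eqI) (auto simp: less3_cases)
    define X where "X = T + (- a) \<cdot>\<^sub>m 1\<^sub>m 3"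
    have X: "X \<in> carrier_mat 3 3" using T by (simp add: X_def)
    have Xd: "X = diag3 0 (d - a) (d - a)"
      unfolding X_def Td by (intro mat3_eqI) (auto simp: less3_cases)
    have "X = 0\<^sub>m 3 3"
    proof (rule irreducible3D[OF irr X])
      show "det X = 0" by (simp add: Xd)
      have "T * S = S * T" unfolding Td S
        by (rule mat3_eqI) (auto simp: less3_cases mult_mat3_index simp del: index_mult_mat(1))
      then have "T * Y = Y * T" if "Y \<in> {A, S, t}" for Y using that TA Tt by auto
      then have "X * Y = Y * X" if "Y \<in> {A, S, t}" for Y
        using that A Sc tc T by (auto simp: X_def mat3_ring_simps)
      then show "\<exists>M\<in>carrier_mat 3 3. X * Y = M * X" if "Y \<in> {A, S, t}" for Y
        using that A Sc tc by blast
    qed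
    then have "X $$ (Suc 0, Suc 0) = 0" by simp
    then have "d = a" by (simp add: Xd)
    then have "T = a \<cdot>\<^sub>m 1\<^sub>m 3"
      unfolding Td by (intro mat3_eqI) (auto simp: less3_cases)
    then show ?thesis by blast
  next
    case 2
    \<comment> \<open>The range of \<open>T - a\<close> is the first coordinate axis, so
      \<open>A\<close> preserves this axis, as do \<open>S\<close> and \<open>t\<close>.\<close>
    then have "d = a" using bad by simp
    have Az: "A $$ (Suc 0, 0) = 0" "A $$ (2, 0) = 0"
      using TA_index[of "Suc 0" "Suc 0"] TA_index[of 2 "Suc 0"] T A 2
      by (simp_all add: mult_mat3_index Ti \<open>d = a\<close> del: index_mult_mat(1))
    let ?X = "diag3 0 1 1 :: complex mat"
    have XA: "?X * A = ?X * A * ?X"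
      by (rule mat3_eqI)
        (use A Az in \<open>auto simp: less3_cases mult_mat3_index simp del: index_mult_mat(1)\<close>)
    have XS: "?X * S = S * ?X" unfolding S
      by (rule mat3_eqI) (auto simp: less3_cases mult_mat3_index simp del: index_mult_mat(1))
    have Xt: "?X * t = t * ?X" unfolding t
      by (rule mat3_eqI) (auto simp: less3_cases mult_mat3_index simp del: index_mult_mat(1))
    have "?X = 0\<^sub>m 3 3"
    proof (rule irreducible3D[OF irr])
      show "\<exists>M\<in>carrier_mat 3 3. ?X * Y = M * ?X" if "Y \<in> {A, S, t}" for Y
        using that XA XS Xt A Sc tc mult_carrier_mat[of ?X 3 3 A 3] by auto
    qed simp_all
    then have "?X $$ (Suc 0, Suc 0) = 0" by simp
    then show ?thesis by simp
  next
    case 3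
    \<comment> \<open>Dually, the kernel of \<open>T - a\<close> is the plane of the last two
      coordinates.\<close>
    then have "d = a" using cad by simp
    have Az: "A $$ (0, Suc 0) = 0" "A $$ (0, 2) = 0"
      using TA_index[of "Suc 0" "Suc 0"] TA_index[of "Suc 0" 2] T A 3
      by (simp_all add: mult_mat3_index Ti \<open>d = a\<close> del: index_mult_mat(1))
    let ?X = "diag3 1 0 0 :: complex mat"
    have XA: "?X * A = (A $$ (0, 0) \<cdot>\<^sub>m 1\<^sub>m 3) * ?X"
      by (rule mat3_eqI)
        (use A Az in \<open>auto simp: less3_cases mult_mat3_index simp del: index_mult_mat(1)\<close>)
    have XS: "?X * S = S * ?X" unfolding S
      by (rule mat3_eqI) (auto simp: less3_cases mult_mat3_index simp del: index_mult_mat(1))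
    have Xt: "?X * t = t * ?X" unfolding t
      by (rule mat3_eqI) (auto simp: less3_cases mult_mat3_index simp del: index_mult_mat(1))
    have "?X = 0\<^sub>m 3 3"
    proof (rule irreducible3D[OF irr])
      show "\<exists>M\<in>carrier_mat 3 3. ?X * Y = M * ?X" if "Y \<in> {A, S, t}" for Y
        using that XA XS Xt Sc tc by auto
    qed simp_all
    then have "?X $$ (0, 0) = 0" by simp
    then show ?thesis by simp
  next
    case 4
    then have "b \<noteq> 0" "c \<noteq> 0" using bcf by auto
    then have "d = a" using bad by simp
    have e0: "e \<noteq> 0" using e by auto
    \<comment> \<open>With this \<open>m\<close> the diagonal of \<open>T - m\<close> is constantly
      \<open>e f\<close>, and \<open>b c = f^2\<close> makes all its minors of size two vanish.
      Scaling by \<open>e f\<close> gives \<open>N\<close> the diagonal \<open>f^2\<close>.\<close>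
    define m where "m = a - e * f"
    define v p where "v = (\<lambda>i. [e * b, f, e * f] ! i)" and "p = (\<lambda>j. [e * c, f, e * f] ! j)"
    define N where "N = mat 3 3 (\<lambda>(i, j). v i * p j)"
    have Nc: "N \<in> carrier_mat 3 3" by (simp add: N_def)
    have vpi: "v 0 = e * b" "v (Suc 0) = f" "v 2 = e * f" "p 0 = e * c" "p (Suc 0) = f" "p 2 = e * f"
      by (simp_all add: v_def p_def)
    have vp: "v 0 * p 0 = f * f" "v (Suc 0) * p (Suc 0) = f * f" "v 2 * p 2 = f * f"
      using bcf by (simp_all add: vpi mult_ac e e')
    have TmN: "T = m \<cdot>\<^sub>m 1\<^sub>m 3 + (e / f) \<cdot>\<^sub>m N"
    proof (rule mat3_eqI)
      fix i j :: nat assume ij: "i < 3" "j < 3"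
      have "v i * p j * e = f * (T $$ (i, j) - m * (1\<^sub>m 3) $$ (i, j))"
        using ij unfolding less3_cases
        by (elim disjE; simp add: vpi Ti m_def \<open>d = a\<close> algebra_simps e e' bcf mult_ac)
      then show "T $$ (i, j) = (m \<cdot>\<^sub>m 1\<^sub>m 3 + (e / f) \<cdot>\<^sub>m N) $$ (i, j)"
        using ij 4 Nc by (simp add: N_def field_simps)
    qed (use T Nc in auto)
    have NN: "N * N = (3 * f * f) \<cdot>\<^sub>m N"
    proof (rule mat3_eqI)
      fix i j :: nat assume ij: "i < 3" "j < 3"
      have "(N * N) $$ (i, j) = v i * p j * (v 0 * p 0 + v (Suc 0) * p (Suc 0) + v 2 * p 2)"
        using ij Nc by (simp add: mult_mat3_index del: index_mult_mat(1)) (simp add: N_def algebra_simps)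
      then show "(N * N) $$ (i, j) = ((3 * f * f) \<cdot>\<^sub>m N) $$ (i, j)"
        unfolding vp using ij by (simp add: N_def)
    qed (use Nc in auto)
    have TN: "T * N = (m + e / f * (3 * f * f)) \<cdot>\<^sub>m N" "N * T = (m + e / f * (3 * f * f)) \<cdot>\<^sub>m N"
      unfolding TmN using Nc
      by (simp_all add: mat3_ring_simps NN add_smult_distrib_right_mat[of _ 3 3])
    have N_T: "N = (e * f) \<cdot>\<^sub>m T + (- (e * f * m)) \<cdot>\<^sub>m 1\<^sub>m 3"
    proof (rule mat3_eqI)
      fix i j :: nat assume ij: "i < 3" "j < 3"
      show "N $$ (i, j) = ((e * f) \<cdot>\<^sub>m T + (- (e * f * m)) \<cdot>\<^sub>m 1\<^sub>m 3) $$ (i, j)"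
        unfolding TmN using ij Nc 4 e' by (simp add: algebra_simps)
    qed (use T Nc in auto)
    have NA: "N * A = A * N"
      unfolding N_T using A T by (simp add: mat3_ring_simps TA)
    show ?thesis
      using commutant_rank_one_trace[OF A A' A'A T w S N_def vp _ NA TN STS] 4 by simp
  qed
qed


section \<open>Matrix relations of the loop braid group\<close>

text \<open>The matrices \<open>A\<close>, \<open>S\<close> and \<open>t\<close> are the images of \<open>\<sigma>\<^sub>1\<close>, \<open>s\<^sub>1 s\<^sub>2\<close> and \<open>s\<^sub>1\<close>, which generate
  the loop braid group: \<open>\<sigma>\<^sub>2\<close> is the conjugate of \<open>\<sigma>\<^sub>1\<close> by \<open>s\<^sub>1 s\<^sub>2\<close>.\<close>

locale loop_braid_matrices =
  fixes A A' S t :: "complex mat"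
  assumes A: "A \<in> carrier_mat 3 3" and A': "A' \<in> carrier_mat 3 3"
    and S: "S \<in> carrier_mat 3 3" and t: "t \<in> carrier_mat 3 3"
    and AA': "A * A' = 1\<^sub>m 3" and A'A: "A' * A = 1\<^sub>m 3"
    and SSS: "S * (S * S) = 1\<^sub>m 3" and tt: "t * t = 1\<^sub>m 3" and tS: "t * S = S * (S * t)"
    and braid: "A * (S * (A * (S * (S * A)))) = S * (A * (S * (S * (A * (S * (A * (S * S)))))))"
    and mixed: "A * (S * (A * (S * (S * t)))) = t * (S * (A * (S * (A * (S * S)))))"
begin

text \<open>\<open>S^-1 A B\<close> with \<open>S * S\<close> as the inverse of \<open>S\<close> and
  \<open>B\<close> expanded as the conjugate of \<open>A\<close>.\<close>

definition T :: "complex mat" where "T = S * (S * (A * (S * (A * (S * S)))))"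

lemma T: "T \<in> carrier_mat 3 3"
  using A S by (simp add: T_def)

lemma SSS': "S * (S * (S * X)) = X" if "X \<in> carrier_mat 3 3"
proof -
  have "S * (S * (S * X)) = (S * (S * S)) * X" using S that by (simp add: assoc3)
  then show ?thesis using that by (simp add: SSS)
qed

lemma tt': "t * (t * X) = X" if "X \<in> carrier_mat 3 3"
  using assoc3[of t t X] t that by (simp add: tt)

lemma tS': "t * (S * X) = S * (S * (t * X))" if "X \<in> carrier_mat 3 3"
proof -
  have "t * (S * X) = (t * S) * X" using S t that by (simp add: assoc3)
  also have "\<dots> = S * (S * (t * X))" using S t that by (simp add: assoc3 tS)
  finally show ?thesis .
qed

text \<open>Since \<open>A B = S T\<close> and \<open>B S = S A\<close>, the braid relation
  \<open>A B A = B A B\<close> reads \<open>S T A = S A T\<close>.\<close>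

lemma T_commutes_A: "T * A = A * T"
proof -
  have "T * A = S * (S * (A * (S * (A * (S * (S * A))))))"
    using A S by (simp add: T_def assoc3)
  also have "\<dots> = A * T"
    using A S by (simp add: braid SSS' T_def)
  finally show ?thesis .
qed

text \<open>The mixed relation \<open>A B t = t S A B\<close> reads \<open>S T t = t S S T\<close>,
  and \<open>t S S = S t\<close>.\<close>

lemma T_commutes_t: "T * t = t * T"
proof -
  have "T * t = S * (S * (A * (S * (A * (S * (S * t))))))"
    using A S t by (simp add: T_def assoc3)
  also have "\<dots> = t * T"
    using A S t by (simp add: mixed tS' SSS' T_def)
  finally show ?thesis .
qed

lemma STS: "S * T * S = A * S * A"
  using A S by (simp add: T_def assoc3 SSS' SSS)

section \<open>Spectrum and commutant of \<open>S\<close>\<close>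

lemma S_not_one:
  assumes "irreducible3 {A, S, t}" shows "S \<noteq> 1\<^sub>m 3"
proof
  assume S1: "S = 1\<^sub>m 3"
  have "T = A * A" unfolding T_def unfolding S1 using A by simp
  then show False
    using irreducible3_pair_square_not_central[of A t] assms A t tt T_commutes_t by (simp add: S1)
qed

lemma S_commutant:
  assumes irr: "irreducible3 {A, S, t}"
    and E: "E \<in> carrier_mat 3 3" and ES: "E * S = S * E"
  shows "\<exists>a b c. E = a \<cdot>\<^sub>m 1\<^sub>m 3 + b \<cdot>\<^sub>m S + c \<cdot>\<^sub>m (S * S)"
proof -
  obtain w :: complex where w: "w * w = - 1 - w" by (rule cube_root_of_unity)
  obtain P Q e where P: "P \<in> carrier_mat 3 3" and Q: "Q \<in> carrier_mat 3 3"
    and PQ: "P * Q = 1\<^sub>m 3" and QP: "Q * P = 1\<^sub>m 3" and D: "Q * S * P = diag3 1 w (w * w)"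
    using diagonalize_S3[OF S t SSS tt tS S_not_one[OF irr] w] by metis
  have PQ': "P * (Q * X) = X" if "X \<in> carrier_mat 3 3" for X
    using assoc3[of P Q X] P Q PQ that by simp
  have PDQ: "P * diag3 1 w (w * w) * Q = S" unfolding D[symmetric] using P Q S by (simp add: assoc3 PQ' PQ)
  have "(Q * E * P) * diag3 1 w (w * w) = diag3 1 w (w * w) * (Q * E * P)"
  proof -
    have "Q * E * P * (Q * S * P) = Q * (E * S) * P" using P Q S E by (simp add: assoc3 PQ')
    also have "\<dots> = Q * S * P * (Q * E * P)" using P Q S E by (simp add: ES assoc3 PQ')
    finally show ?thesis by (simp add: D)
  qed
  then obtain a b c where "Q * E * P = a \<cdot>\<^sub>m 1\<^sub>m 3 + b \<cdot>\<^sub>m diag3 1 w (w * w)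
      + c \<cdot>\<^sub>m (diag3 1 w (w * w) * diag3 1 w (w * w))"
    using commute_diag3[of "Q * E * P" w] w P Q E by auto
  then have "P * (Q * E * P) * Q = P * (a \<cdot>\<^sub>m 1\<^sub>m 3 + b \<cdot>\<^sub>m (Q * S * P)
      + c \<cdot>\<^sub>m ((Q * S * P) * (Q * S * P))) * Q" by (simp only: D)
  then have "E = a \<cdot>\<^sub>m 1\<^sub>m 3 + b \<cdot>\<^sub>m S + c \<cdot>\<^sub>m (S * S)"
    using P Q S E by (simp add: mat3_ring_simps PQ' PQ)
  then show ?thesis by blast
qed

text \<open>The cube of \<open>S T\<close> is a product of the three conjugates of \<open>T\<close> under the powers of \<open>S\<close>, and
  conjugation by \<open>t\<close> exchanges two of them.\<close>

lemma T_commutes_conjugate: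
  assumes cube: "S * T * (S * T) * (S * T) = k \<cdot>\<^sub>m 1\<^sub>m 3"
  shows "T * (S * T * (S * S)) = S * T * (S * S) * T"
proof -
  define U V where "U = S * (T * (S * S))" and "V = S * (S * (T * S))"
  have U: "U \<in> carrier_mat 3 3" and V: "V \<in> carrier_mat 3 3"
    using S T by (simp_all add: U_def V_def)
  \<comment> \<open>In \<open>U V T\<close> the inner powers of \<open>S\<close> combine to
    \<open>S^4 = S\<close>, which leaves the cube of \<open>S T\<close>.\<close>
  have UVT: "U * (V * T) = k \<cdot>\<^sub>m 1\<^sub>m 3"
    using S T cube by (simp add: U_def V_def assoc3 SSS')
  have Tt': "T * (t * X) = t * (T * X)" if "X \<in> carrier_mat 3 3" for X
  proof -
    have "T * (t * X) = (T * t) * X" using T t that by (simp add: assoc3)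
    also have "\<dots> = t * (T * X)" using T t that by (simp add: assoc3 T_commutes_t)
    finally show ?thesis .
  qed
  have St: "S * t = t * (S * S)"
    using S t by (simp add: tS' tS SSS' assoc3)
  have St': "S * (t * X) = t * (S * (S * X))" if "X \<in> carrier_mat 3 3" for X
  proof -
    have "S * (t * X) = (S * t) * X" using S t that by (simp add: assoc3)
    also have "\<dots> = t * (S * (S * X))" using S t that by (simp add: assoc3 St)
    finally show ?thesis .
  qed
  have conj_t: "t * (U * (V * T)) * t = V * (U * T)"
  proof -
    have "U * (V * T) * t = t * (V * (U * T))"
      using S T t by (simp add: U_def V_def assoc3 St' St Tt' T_commutes_t SSS')
    then have "t * (U * (V * T)) * t = t * (t * (V * (U * T)))" using U V T t by (simp add: assoc3)
    then show ?thesis using U V T by (simp add: tt')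
  qed
  have conj_S: "S * (U * (V * T)) * (S * S) = V * (T * U)"
    using S T by (simp add: U_def V_def assoc3 SSS')
  have "V * (U * T) = k \<cdot>\<^sub>m 1\<^sub>m 3"
    unfolding conj_t[symmetric] UVT using t by (simp add: mat3_ring_simps tt)
  moreover have "V * (T * U) = k \<cdot>\<^sub>m 1\<^sub>m 3"
    unfolding conj_S[symmetric] UVT using S by (simp add: mat3_ring_simps SSS)
  \<comment> \<open>Conjugation does not change a scalar, so both products equal \<open>k\<close>;
    cancelling the invertible \<open>V\<close> is all that remains.\<close>
  ultimately have "V * (T * U) = V * (U * T)" by simp
  moreover have "det V \<noteq> 0"
  proof -
    have "det A * det A' = 1" "det S * (det S * det S) = 1"
      using arg_cong[OF AA', of det] arg_cong[OF SSS, of det] A A' S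
      by (simp_all add: det_mult[of _ 3])
    then have "det A \<noteq> 0" "det S \<noteq> 0" by auto
    then show ?thesis using A S T by (simp add: V_def T_def det_mult[of _ 3])
  qed
  from det_non_zero_imp_unit[OF V this, of "()"]
  obtain V' where V': "V' \<in> carrier_mat 3 3" "V' * V = 1\<^sub>m 3"
    by (auto simp: Units_def ring_mat_simps)
  ultimately have "V' * (V * (T * U)) = V' * (V * (U * T))" by simp
  then have "(V' * V) * (T * U) = (V' * V) * (U * T)" using U V V'(1) T by (simp add: assoc3)
  then have "T * U = U * T" using V'(2) U T by simp
  then show ?thesis using S T by (simp add: U_def assoc3)
qed

lemma T_scalar_or_trace:
  assumes irr: "irreducible3 {A, S, t}"
    and cube: "S * T * (S * T) * (S * T) = k \<cdot>\<^sub>m 1\<^sub>m 3"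
    and cp: "char_poly A = [:- l1, 1:] * [:- l2, 1:] * [:- l3, 1:]"
    and l: "(l1 + l2) * (l1 + l3) * (l2 + l3) \<noteq> 0"
  shows "\<exists>k. T = k \<cdot>\<^sub>m 1\<^sub>m 3"
proof -
  obtain w :: complex where w: "w * w = - 1 - w" by (rule cube_root_of_unity)
  obtain P Q e where P: "P \<in> carrier_mat 3 3" and Q: "Q \<in> carrier_mat 3 3"
    and PQ: "P * Q = 1\<^sub>m 3" and QP: "Q * P = 1\<^sub>m 3" and D: "Q * S * P = diag3 1 w (w * w)"
    and e: "e * e = 1" and te: "Q * t * P = swap3 e"
    using diagonalize_S3[OF S t SSS tt tS S_not_one[OF irr] w] by metis
  have PQ': "P * (Q * X) = X" if "X \<in> carrier_mat 3 3" for X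
    using assoc3[of P Q X] P Q PQ that by simp
  define c where "c X = Q * X * P" for X
  have c: "c X \<in> carrier_mat 3 3" if "X \<in> carrier_mat 3 3" for X
    using that P Q by (simp add: c_def)
  have c_mult: "c X * c Y = c (X * Y)" if "X \<in> carrier_mat 3 3" "Y \<in> carrier_mat 3 3" for X Y
    using that P Q by (simp add: c_def assoc3 PQ')
  have "irreducible3 {c A, c S, c t}"
    using irreducible3_conjugate[OF irr _ P Q PQ QP] A S t by (simp add: c_def)
  moreover have "c A' * c A = 1\<^sub>m 3"
    using A A' P Q by (simp add: c_mult A'A) (simp add: c_def QP)
  moreover have "c T * c A = c A * c T" "c T * c t = c t * c T"
    using A T t by (simp_all add: c_mult T_commutes_A T_commutes_t)
  moreover have "c T * (c S * c T * (c S * c S)) = c S * c T * (c S * c S) * c T"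
    "c S * c T * c S = c A * c S * c A"
    using A S T by (simp_all add: c_mult T_commutes_conjugate[OF cube] STS)
  ultimately have "(\<exists>k. c T = k \<cdot>\<^sub>m 1\<^sub>m 3)
      \<or> eigenvalue (c A) (c A $$ (0, 0) + c A $$ (Suc 0, Suc 0) + c A $$ (2, 2))"
    using diagonal_commutant_scalar_or_trace[of "c A" "c S" "c t" "c A'" "c T" w e]
      c[OF A] c[OF A'] c[OF T] w e D te by (simp add: c_def)
  then show ?thesis
  proof
    assume "\<exists>k. c T = k \<cdot>\<^sub>m 1\<^sub>m 3"
    then obtain k where "c T = k \<cdot>\<^sub>m 1\<^sub>m 3" ..
    then have "P * c T * Q = P * (k \<cdot>\<^sub>m 1\<^sub>m 3) * Q" by simp
    then have "T = k \<cdot>\<^sub>m 1\<^sub>m 3"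
      using P Q T by (simp add: c_def mat3_ring_simps PQ PQ')
    then show ?thesis ..
  next
    assume ev: "eigenvalue (c A) (c A $$ (0, 0) + c A $$ (Suc 0, Suc 0) + c A $$ (2, 2))"
    have "similar_mat A (c A)"
      unfolding similar_mat_def similar_mat_wit_def
      using A P Q PQ QP c[OF A] by (intro exI[of _ P] exI[of _ Q]) (simp add: c_def assoc3 PQ' Let_def)
    then have cp': "char_poly (c A) = [:- l1, 1:] * [:- l2, 1:] * [:- l3, 1:]"
      using char_poly_similar cp by metis
    have "eigenvalue (c A) (l1 + l2 + l3)"
      using ev by (simp only: char_poly_mat3_trace[OF c[OF A] cp'])
    \<comment> \<open>At the trace each linear factor becomes the sum of the two other
      eigenvalues.\<close>
    then have "poly ([:- l1, 1:] * [:- l2, 1:] * [:- l3, 1:]) (l1 + l2 + l3) = 0"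
      using eigenvalue_root_char_poly[OF c[OF A]] by (simp only: cp')
    then have "(l2 + l3) * (l1 + l3) * (l1 + l2) = 0" by (simp add: algebra_simps)
    then show ?thesis using l by simp
  qed
qed

text \<open>The product on the right is \<open>A B = S T\<close>, and \<open>k\<close> can be
  inverted because \<open>T\<close> is a product of invertible matrices.\<close>

lemma S_multiple_of_product:
  assumes "T = k \<cdot>\<^sub>m 1\<^sub>m 3"
  shows "\<exists>k. S = k \<cdot>\<^sub>m (A * (S * A * (S * S)))"
proof -
  have ST: "S * T = A * (S * A * (S * S))"
    using A S by (simp add: T_def assoc3 SSS')
  have kS: "k \<cdot>\<^sub>m S = A * (S * A * (S * S))"
    using S by (simp add: assms mat3_ring_simps flip: ST)
  have "k \<noteq> 0"
  proof
    assume "k = 0"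
    then have "T = 0\<^sub>m 3 3" unfolding assms by (auto intro!: mat3_eqI)
    then have "det T = 0" by (simp add: det_mat3)
    moreover have "det A * det A' = 1" "det S * (det S * det S) = 1"
      using arg_cong[OF AA', of det] arg_cong[OF SSS, of det] A A' S
      by (simp_all add: det_mult[of _ 3])
    ultimately show False using A S by (auto simp: T_def det_mult[of _ 3])
  qed
  then have "S = (1 / k) \<cdot>\<^sub>m (k \<cdot>\<^sub>m S)" using S by (auto intro!: mat3_eqI)
  then show ?thesis unfolding kS by blast
qed

end


section \<open>Representations of the loop braid group\<close>

lemma representation_LB3_word:
  assumes "representation LB3 n \<rho>"
  shows "\<rho> (pres_class lb3_relations u) \<in> carrier_mat n n"
    and "\<rho> (pres_class lb3_relations (u @ v)) =
      \<rho> (pres_class lb3_relations u) * \<rho> (pres_class lb3_relations v)"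
    and "\<rho> (pres_class lb3_relations []) = 1\<^sub>m n"
proof -
  let ?R = "ring_mat TYPE(complex) n ()"
  interpret R: ring ?R by (rule ring_mat)
  have hom: "\<rho> \<in> hom LB3 (GL n)" using assms by (simp add: representation_def)
  have c: "pres_class lb3_relations u \<in> carrier LB3" for u
    by (simp add: LB3_def presented_group_def)
  have U: "\<rho> (pres_class lb3_relations u) \<in> Units ?R" for u
    using hom_in_carrier[OF hom c] by (simp add: GL_def units_of_def)
  then show "\<rho> (pres_class lb3_relations u) \<in> carrier_mat n n"
    using R.Units_closed by (fastforce simp: ring_mat_simps)
  show "\<rho> (pres_class lb3_relations (u @ v)) =
      \<rho> (pres_class lb3_relations u) * \<rho> (pres_class lb3_relations v)"
    using hom_mult[OF hom c c, of u v]
    by (simp add: LB3_def presented_group_mult GL_def units_of_def ring_mat_simps)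
  have "group (GL n)" unfolding GL_def by (rule R.units_group)
  from hom_one[OF hom group_LB3 this]
  show "\<rho> (pres_class lb3_relations []) = 1\<^sub>m n"
    by (simp add: LB3_def presented_group_def GL_def units_of_def ring_mat_simps)
qed

lemma representation_LB3_pos_word:
  assumes "representation LB3 n \<rho>"
  shows "\<rho> (pres_class lb3_relations (pos_word gs)) = foldr (\<lambda>g M. \<rho> (lb3 g) * M) gs (1\<^sub>m n)"
proof (induction gs)
  case (Cons g gs)
  have "pos_word (g # gs) = pos_word [g] @ pos_word gs" by (simp add: pos_word_def)
  then show ?case
    using Cons representation_LB3_word(2)[OF assms, of "pos_word [g]" "pos_word gs"]
    by (simp add: lb3_def)
qed (simp add: pos_word_def representation_LB3_word(3)[OF assms])

lemma representation_LB3_inverse_letter: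
  assumes "representation LB3 n \<rho>"
  shows "\<rho> (pres_class lb3_relations [(g, b)]) * \<rho> (pres_class lb3_relations [(g, \<not> b)]) = 1\<^sub>m n"
proof -
  have "pres_class lb3_relations ([(g, b)] @ [(g, \<not> b)]) = pres_class lb3_relations []"
    by (simp add: pres_class_eq_iff pres_eq.cancel)
  then show ?thesis
    using representation_LB3_word(2)[OF assms, of "[(g, b)]" "[(g, \<not> b)]"]
      representation_LB3_word(3)[OF assms] by metis
qed

lemma representation_LB3_relations:
  fixes \<rho> :: "lb3_gen word set \<Rightarrow> complex mat"
  assumes rep: "representation LB3 3 \<rho>"
  defines "A \<equiv> \<rho> (lb3 Sigma1)" and "B \<equiv> \<rho> (lb3 Sigma2)" and "t \<equiv> \<rho> (lb3 S1)" and "u \<equiv> \<rho> (lb3 S2)"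
  shows "A * (B * A) = B * (A * B)" "t * (u * t) = u * (t * u)" "t * t = 1\<^sub>m 3" "u * u = 1\<^sub>m 3"
    "t * (u * A) = B * (t * u)" "A * (B * t) = u * (A * B)"
proof -
  have c: "\<rho> (lb3 g) \<in> carrier_mat 3 3" for g
    using representation_LB3_word(1)[OF rep] by (simp add: lb3_def)
  have "foldr (\<lambda>g M. \<rho> (lb3 g) * M) gs (1\<^sub>m 3) = foldr (\<lambda>g M. \<rho> (lb3 g) * M) hs (1\<^sub>m 3)"
    if "(pos_word gs, pos_word hs) \<in> lb3_relations" for gs hs
  proof -
    have "pres_class lb3_relations (pos_word gs) = pres_class lb3_relations (pos_word hs)"
      using pres_eq.rel[OF that] by (simp add: pres_class_eq_iff)
    then show ?thesis by (metis representation_LB3_pos_word[OF rep])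
  qed
  note r = this
  show "A * (B * A) = B * (A * B)"
    using r[of "[Sigma1, Sigma2, Sigma1]" "[Sigma2, Sigma1, Sigma2]"] c
    by (simp add: lb3_relations_def A_def B_def right_mult_one_mat[of _ 3 3])
  show "t * (u * t) = u * (t * u)"
    using r[of "[S1, S2, S1]" "[S2, S1, S2]"] c
    by (simp add: lb3_relations_def t_def u_def right_mult_one_mat[of _ 3 3])
  show "t * t = 1\<^sub>m 3" "u * u = 1\<^sub>m 3"
    using r[of "[S1, S1]" "[]"] r[of "[S2, S2]" "[]"] c
    by (simp_all add: lb3_relations_def t_def u_def right_mult_one_mat[of _ 3 3])
  show "t * (u * A) = B * (t * u)"
    using r[of "[S1, S2, Sigma1]" "[Sigma2, S1, S2]"] c
    by (simp add: lb3_relations_def A_def B_def t_def u_def right_mult_one_mat[of _ 3 3])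
  show "A * (B * t) = u * (A * B)"
    using r[of "[Sigma1, Sigma2, S1]" "[S2, Sigma1, Sigma2]"] c
    by (simp add: lb3_relations_def A_def B_def t_def u_def right_mult_one_mat[of _ 3 3])
qed

text \<open>\<open>s1 s2 \<sigma>1 = \<sigma>2 s1 s2\<close> expresses the image of
  \<open>Sigma2\<close> as a conjugate, and \<open>s1^2 = 1\<close> recovers \<open>s2\<close> as
  \<open>t S\<close>; the other relations are rewritten in \<open>A\<close>, \<open>S\<close> and
  \<open>t\<close>.\<close>

lemma representation_LB3_matrices:
  fixes \<rho> :: "lb3_gen word set \<Rightarrow> complex mat"
  assumes rep: "representation LB3 3 \<rho>"
  defines "A \<equiv> \<rho> (lb3 Sigma1)" and "t \<equiv> \<rho> (lb3 S1)"
    and "S \<equiv> \<rho> (lb3 S1 \<otimes>\<^bsub>LB3\<^esub> lb3 S2)"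
  shows "\<exists>A'. loop_braid_matrices A A' S t"
    and "\<rho> (lb3 Sigma2) = S * A * (S * S)" and "\<rho> (lb3 S2) = t * S"
proof -
  define A' where "A' = \<rho> (pres_class lb3_relations [(Sigma1, False)])"
  define B u where "B = \<rho> (lb3 Sigma2)" and "u = \<rho> (lb3 S2)"
  have c: "A \<in> carrier_mat 3 3" "t \<in> carrier_mat 3 3" "A' \<in> carrier_mat 3 3" "B \<in> carrier_mat 3 3"
    "u \<in> carrier_mat 3 3"
    using representation_LB3_word(1)[OF rep] by (simp_all add: A_def t_def A'_def B_def u_def lb3_def)
  have Su: "S = t * u"
    using representation_LB3_word(2)[OF rep, of "pos_word [S1]" "pos_word [S2]"]
    by (simp add: S_def t_def u_def lb3_def LB3_def presented_group_mult)
  have S: "S \<in> carrier_mat 3 3" using c by (simp add: Su)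
  note rels = representation_LB3_relations[OF rep, folded A_def t_def B_def u_def]
  have tt': "t * (t * X) = X" if "X \<in> carrier_mat 3 3" for X
    using assoc3[of t t X] c that by (simp add: rels)
  have uu': "u * (u * X) = X" if "X \<in> carrier_mat 3 3" for X
    using assoc3[of u u X] c that by (simp add: rels)
  have u: "u = t * S" using c by (simp add: Su tt')
  have utu': "u * (t * (u * X)) = t * (u * (t * X))" if "X \<in> carrier_mat 3 3" for X
  proof -
    have "u * (t * (u * X)) = (u * (t * u)) * X" using c that by (simp add: assoc3)
    also have "\<dots> = t * (u * (t * X))" using c that by (simp add: assoc3 flip: rels(2))
    finally show ?thesis .
  qed
  have SSS: "S * (S * S) = 1\<^sub>m 3"
    using c by (simp add: Su assoc3 utu' tt' uu' rels)
  have tS: "t * S = S * (S * t)"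
    using c by (simp add: Su assoc3 utu' tt' uu' rels)
  have B: "B = S * A * (S * S)"
  proof -
    have "S * A * (S * S) = (t * (u * A)) * (S * S)" using c S by (simp add: Su assoc3)
    also have "\<dots> = B * (S * (S * S))" unfolding rels(5) using c by (simp add: Su assoc3)
    finally show ?thesis using c by (simp add: SSS)
  qed
  have "loop_braid_matrices A A' S t"
  proof
    show "A * A' = 1\<^sub>m 3" "A' * A = 1\<^sub>m 3"
      using representation_LB3_inverse_letter[OF rep, of Sigma1 True]
        representation_LB3_inverse_letter[OF rep, of Sigma1 False]
      by (simp_all add: A_def A'_def lb3_def pos_word_def)
    show "A * (S * (A * (S * (S * A)))) = S * (A * (S * (S * (A * (S * (A * (S * S)))))))"
      using rels(1) c S by (simp add: B assoc3)
    show "A * (S * (A * (S * (S * t)))) = t * (S * (A * (S * (A * (S * S)))))"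
      using rels(6) c S by (simp add: B u assoc3)
  qed (use c S SSS tS rels in auto)
  then show "\<exists>A'. loop_braid_matrices A A' S t" ..
  show "\<rho> (lb3 Sigma2) = S * A * (S * S)" using B by (simp add: B_def)
  show "\<rho> (lb3 S2) = t * S" using u by (simp add: u_def)
qed

section \<open>Invariant subspaces and irreducibility of representations\<close>

lemma vec_subspace_iff:
  "VectorSpace.subspace class_ring W (module_vec TYPE('a::field) n) \<longleftrightarrow>
    W \<subseteq> carrier_vec n \<and> 0\<^sub>v n \<in> W \<and> (\<forall>v\<in>W. \<forall>w\<in>W. v + w \<in> W) \<and> (\<forall>c. \<forall>v\<in>W. c \<cdot>\<^sub>v v \<in> W)"
  using vec_vs[where 'a = 'a and n = n] vec_module[where 'a = 'a and n = n]
  by (auto simp: VectorSpace.subspace_def submodule_def module_vec_simps class_ring_simps)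

definition preserves :: "'a::semiring_0 mat \<Rightarrow> 'a vec set \<Rightarrow> bool" where
  "preserves M W \<longleftrightarrow> (\<forall>w\<in>W. M *\<^sub>v w \<in> W)"

lemma preserves_mult:
  assumes "preserves M W" "preserves N W" "W \<subseteq> carrier_vec 3"
    and "M \<in> carrier_mat 3 3" "N \<in> carrier_mat 3 3"
  shows "preserves (M * N) W"
  using assms by (auto simp: preserves_def assoc_mult_mat_vec[of _ 3 3 _ 3] subset_iff)

lemma smult_mat_mult_vec:
  "dim_vec v = dim_col M \<Longrightarrow> (k \<cdot>\<^sub>m M) *\<^sub>v v = k \<cdot>\<^sub>v (M *\<^sub>v v :: 'a::comm_semiring_0 vec)"
  by (intro eq_vecI) (auto simp: scalar_prod_def sum_distrib_left mult.assoc)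

lemma preserves_quadratic:
  fixes M :: "'a::field mat"
  assumes W: "VectorSpace.subspace class_ring W (module_vec TYPE('a) 3)"
    and M: "M \<in> carrier_mat 3 3" "preserves M W"
  shows "preserves (a \<cdot>\<^sub>m 1\<^sub>m 3 + b \<cdot>\<^sub>m M + c \<cdot>\<^sub>m (M * M)) W"
  unfolding preserves_def
proof
  fix w assume w: "w \<in> W"
  have W': "W \<subseteq> carrier_vec 3" "\<And>v w. v \<in> W \<Longrightarrow> w \<in> W \<Longrightarrow> v + w \<in> W" "\<And>c v. v \<in> W \<Longrightarrow> c \<cdot>\<^sub>v v \<in> W"
    using W by (auto simp: vec_subspace_iff)
  have wc: "w \<in> carrier_vec 3" using w W' by auto
  have "(a \<cdot>\<^sub>m 1\<^sub>m 3 + b \<cdot>\<^sub>m M + c \<cdot>\<^sub>m (M * M)) *\<^sub>v w = a \<cdot>\<^sub>v w + b \<cdot>\<^sub>v (M *\<^sub>v w) + c \<cdot>\<^sub>v (M *\<^sub>v (M *\<^sub>v w))"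
    using M(1) wc
    by (simp add: add_mult_distrib_mat_vec[of _ 3 3] smult_mat_mult_vec)
  then show "(a \<cdot>\<^sub>m 1\<^sub>m 3 + b \<cdot>\<^sub>m M + c \<cdot>\<^sub>m (M * M)) *\<^sub>v w \<in> W"
    using W' M(2) w by (simp add: preserves_def)
qed

text \<open>The images of \<open>Sigma2\<close> and \<open>S2\<close> are products of the three
  given matrices, and the image of an inverse letter is a polynomial in that of the letter; words
  follow by induction.\<close>

lemma representation_LB3_preserves:
  fixes \<rho> :: "lb3_gen word set \<Rightarrow> complex mat"
  assumes rep: "representation LB3 3 \<rho>"
    and W: "VectorSpace.subspace class_ring W (module_vec TYPE(complex) 3)"
    and A: "preserves (\<rho> (lb3 Sigma1)) W" and t: "preserves (\<rho> (lb3 S1)) W"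
    and S: "preserves (\<rho> (lb3 S1 \<otimes>\<^bsub>LB3\<^esub> lb3 S2)) W"
    and g: "g \<in> carrier LB3"
  shows "preserves (\<rho> g) W"
proof -
  have Wc: "W \<subseteq> carrier_vec 3" using W by (simp add: vec_subspace_iff)
  obtain A' where "loop_braid_matrices (\<rho> (lb3 Sigma1)) A' (\<rho> (lb3 S1 \<otimes>\<^bsub>LB3\<^esub> lb3 S2)) (\<rho> (lb3 S1))"
    using representation_LB3_matrices(1)[OF rep] by blast
  then have carr: "\<rho> (lb3 Sigma1) \<in> carrier_mat 3 3" "\<rho> (lb3 S1 \<otimes>\<^bsub>LB3\<^esub> lb3 S2) \<in> carrier_mat 3 3"
      "\<rho> (lb3 S1) \<in> carrier_mat 3 3"
    by (simp_all add: loop_braid_matrices_def)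
  let ?L = "\<lambda>u. \<rho> (pres_class lb3_relations u)"
  have c: "?L u \<in> carrier_mat 3 3" for u by (rule representation_LB3_word(1)[OF rep])
  have pos: "preserves (\<rho> (lb3 x)) W" for x
    using A t S Wc carr
    by (cases x) (auto simp: representation_LB3_matrices(2,3)[OF rep] intro!: preserves_mult)
  have letter: "preserves (?L [(x, b)]) W" for x b
  proof (cases b)
    case True
    then show ?thesis using pos[of x] by (simp add: lb3_def pos_word_def)
  next
    case False
    have "?L [(x, True)] * ?L [(x, False)] = 1\<^sub>m 3"
      using representation_LB3_inverse_letter[OF rep, of x True] by simp
    then obtain p q r where "?L [(x, False)] = p \<cdot>\<^sub>m 1\<^sub>m 3 + q \<cdot>\<^sub>m ?L [(x, True)]
        + r \<cdot>\<^sub>m (?L [(x, True)] * ?L [(x, True)])"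
      using inverse_mat3_polynomial[OF c c] by blast
    then show ?thesis
      using preserves_quadratic[OF W c] pos[of x] False by (simp add: lb3_def pos_word_def)
  qed
  have word: "preserves (?L u) W" for u
  proof (induction u)
    case Nil
    show ?case using Wc by (auto simp: representation_LB3_word(3)[OF rep] preserves_def)
  next
    case (Cons x u)
    have "?L (x # u) = ?L [x] * ?L u"
      using representation_LB3_word(2)[OF rep, of "[x]" u] by simp
    then show ?case
      using preserves_mult[OF letter[of "fst x" "snd x"] Cons Wc c c] by simp
  qed
  show ?thesis using g word by (auto simp: LB3_def presented_group_def)
qed

text \<open>The kernel of a witness \<open>X\<close> is an invariant subspace, nonzero because
  \<open>det X = 0\<close>, hence the whole space.\<close>

lemma irreducible_representation_LB3_irreducible3:
  fixes \<rho> :: "lb3_gen word set \<Rightarrow> complex mat"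
  assumes irr: "irreducible_representation LB3 3 \<rho>"
  shows "irreducible3 {\<rho> (lb3 Sigma1), \<rho> (lb3 S1 \<otimes>\<^bsub>LB3\<^esub> lb3 S2), \<rho> (lb3 S1)}"
    (is "irreducible3 ?G")
  unfolding irreducible3_def
proof (intro ballI impI, elim conjE)
  fix X :: "complex mat"
  assume X: "X \<in> carrier_mat 3 3" and det: "det X = 0"
    and inv: "\<forall>A\<in>?G. \<exists>M\<in>carrier_mat 3 3. X * A = M * X"
  have rep: "representation LB3 3 \<rho>" using irr by (simp add: irreducible_representation_def)
  obtain A' where "loop_braid_matrices (\<rho> (lb3 Sigma1)) A' (\<rho> (lb3 S1 \<otimes>\<^bsub>LB3\<^esub> lb3 S2)) (\<rho> (lb3 S1))"
    using representation_LB3_matrices(1)[OF rep] by blast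
  then have c: "?G \<subseteq> carrier_mat 3 3" by (simp add: loop_braid_matrices_def)
  define W where "W = {w \<in> carrier_vec 3. X *\<^sub>v w = 0\<^sub>v 3}"
  have W: "VectorSpace.subspace class_ring W (module_vec TYPE(complex) 3)"
    using X by (auto simp: vec_subspace_iff W_def mult_add_distrib_mat_vec[of _ 3 3] mult_mat_vec[of _ 3 3])
  have pres: "preserves Y W" if Y: "Y \<in> ?G" for Y
    unfolding preserves_def
  proof
    fix w assume w: "w \<in> W"
    obtain M where M: "M \<in> carrier_mat 3 3" "X * Y = M * X" using inv Y by blast
    have Yc: "Y \<in> carrier_mat 3 3" using Y c by auto
    have wc: "w \<in> carrier_vec 3" and Xw: "X *\<^sub>v w = 0\<^sub>v 3" using w by (simp_all add: W_def)
    have "X *\<^sub>v (Y *\<^sub>v w) = (X * Y) *\<^sub>v w"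
      using X Yc wc by (simp add: assoc_mult_mat_vec[of _ 3 3 _ 3])
    also have "\<dots> = M *\<^sub>v (X *\<^sub>v w)"
      unfolding M(2) using X M(1) wc by (simp add: assoc_mult_mat_vec[of _ 3 3 _ 3])
    also have "\<dots> = 0\<^sub>v 3" using M(1) by (simp add: Xw)
    finally show "Y *\<^sub>v w \<in> W" using Yc wc by (simp add: W_def)
  qed
  have "\<forall>g\<in>carrier LB3. \<forall>w\<in>W. \<rho> g *\<^sub>v w \<in> W"
    using representation_LB3_preserves[OF rep W] pres by (simp add: preserves_def)
  then have "W = {0\<^sub>v 3} \<or> W = carrier_vec 3"
    using irr W by (auto simp: irreducible_representation_def)
  moreover have "W \<noteq> {0\<^sub>v 3}"
    using det_0_iff_vec_prod_zero[OF X] det by (auto simp: W_def)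
  ultimately have "W = carrier_vec 3" by blast
  have "X *\<^sub>v unit_vec 3 j = 0\<^sub>v 3" for j
  proof -
    have "unit_vec 3 j \<in> W" unfolding \<open>W = carrier_vec 3\<close> by simp
    then show ?thesis by (simp add: W_def)
  qed
  moreover have "X *\<^sub>v unit_vec 3 j = col X j" if "j < 3" for j
    using X that by (intro eq_vecI) (auto simp: scalar_prod_right_unit[of _ 3])
  ultimately have "col X j $ i = 0" if "i < 3" "j < 3" for i j
    using that by (metis index_zero_vec(1))
  then show "X = 0\<^sub>m 3 3"
    using X by (intro mat3_eqI) auto
qed

theorem theorem4p5:
  fixes \<rho> :: "lb3_gen word set \<Rightarrow> complex mat"
    and A B S :: "complex mat"
    and l1 l2 l3 :: complex
  assumes irr: "irreducible_representation LB3 3 \<rho>"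
    and A: "\<rho> (lb3 Sigma1) = A"
    and B: "\<rho> (lb3 Sigma2) = B"
    and specA: "char_poly A = [:- l1, 1:] * [:- l2, 1:] * [:- l3, 1:]"
    and specB: "char_poly B = [:- l1, 1:] * [:- l2, 1:] * [:- l3, 1:]"
    and S: "\<rho> (lb3 S1 \<otimes>\<^bsub>LB3\<^esub> lb3 S2) = S"
  shows "(\<forall>\<psi>. representation LB3 3 \<psi> \<and> \<psi> (lb3 Sigma1) = A \<and> \<psi> (lb3 Sigma2) = B \<and>
              \<psi> (lb3 S1 \<otimes>\<^bsub>LB3\<^esub> lb3 S2) = S \<longrightarrow>
            irreducible_representation LB3 3 \<psi>)
       \<and> (is_minimal_poly A (char_poly A) \<and> is_minimal_poly B (char_poly B) \<and>
          (\<exists>c. (A * B) ^\<^sub>m 3 = c \<cdot>\<^sub>m 1\<^sub>m 3) \<and>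
          (l1 + l2) * (l1 + l3) * (l2 + l3) \<noteq> 0 \<longrightarrow>
            (\<exists>k. \<rho> (lb3 S1 \<otimes>\<^bsub>LB3\<^esub> lb3 S2) = k \<cdot>\<^sub>m (A * B)))"
proof -
  define t where "t = \<rho> (lb3 S1)"
  have rep: "representation LB3 3 \<rho>" using irr by (simp add: irreducible_representation_def)
  obtain A' where "loop_braid_matrices A A' S t"
    using representation_LB3_matrices(1)[OF rep] A S by (auto simp: t_def)
  then interpret rho: loop_braid_matrices A A' S t .
  have irr3: "irreducible3 {A, S, t}"
    using irreducible_representation_LB3_irreducible3[OF irr] by (simp add: A S t_def)
  have B_eq: "B = S * A * (S * S)"
    using representation_LB3_matrices(2)[OF rep] by (simp add: A B S)
  note c = rho.loop_braid_matrices_axioms[unfolded loop_braid_matrices_def]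
  have part_a: "irreducible_representation LB3 3 \<psi>"
    if rep': "representation LB3 3 \<psi>" and A\<psi>: "\<psi> (lb3 Sigma1) = A"
      and S\<psi>: "\<psi> (lb3 S1 \<otimes>\<^bsub>LB3\<^esub> lb3 S2) = S" for \<psi>
    unfolding irreducible_representation_def
  proof (intro conjI allI impI, goal_cases)
    case (3 W)
    then have W: "VectorSpace.subspace class_ring W (module_vec TYPE(complex) 3)"
      and inv: "\<And>g. g \<in> carrier LB3 \<Longrightarrow> preserves (\<psi> g) W"
      by (auto simp: preserves_def)
    have Wc: "W \<subseteq> carrier_vec 3" using W by (simp add: vec_subspace_iff)
    define t' where "t' = \<psi> (lb3 S1)"
    obtain A'' where "loop_braid_matrices A A'' S t'"
      using representation_LB3_matrices(1)[OF rep'] A\<psi> S\<psi> by (auto simp: t'_def)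
    then interpret psi: loop_braid_matrices A A'' S t' .
    have t'c: "t' \<in> carrier_mat 3 3" by (rule psi.t)
    \<comment> \<open>Two involutions inverting \<open>S\<close> differ by a matrix commuting with \<open>S\<close>.\<close>
    have "t * t' * S = S * (t * t')"
      using c t'c by (simp add: assoc3 psi.tS rho.tS' rho.SSS')
    then obtain p q r where E: "t * t' = p \<cdot>\<^sub>m 1\<^sub>m 3 + q \<cdot>\<^sub>m S + r \<cdot>\<^sub>m (S * S)"
      using rho.S_commutant[OF irr3, of "t * t'"] c t'c by auto
    have gens: "preserves A W" "preserves t' W" "preserves S W"
      using inv[OF lb3_in_carrier, of Sigma1] inv[OF lb3_in_carrier, of S1]
        inv[OF group.subgroupE(4)[OF group_LB3 group.subgroup_self[OF group_LB3] lb3_in_carrier lb3_in_carrier], of S1 S2]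
      by (simp_all add: A\<psi> S\<psi> t'_def)
    \<comment> \<open>\<open>t\<close> is recovered as \<open>(t t') t'\<close>, a polynomial in
      \<open>S\<close> times \<open>t'\<close>, and both factors preserve \<open>W\<close>.\<close>
    have "preserves (t * t' * t') W"
      using preserves_mult[OF _ gens(2) Wc, of "t * t'"] preserves_quadratic[OF W _ gens(3)] c t'c
      by (simp add: E)
    moreover have "t * t' * t' = t" using rho.t t'c by (simp add: assoc3 psi.tt)
    ultimately have "preserves t W" by simp
    then have "\<forall>g\<in>carrier LB3. \<forall>w\<in>W. \<rho> g *\<^sub>v w \<in> W"
      using representation_LB3_preserves[OF rep W] gens A S by (simp add: preserves_def t_def)
    then show ?case using irr W by (auto simp: irreducible_representation_def)
  qed (use rep' in auto)
  have part_b: "\<exists>k. S = k \<cdot>\<^sub>m (A * B)"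
    if cube: "(A * B) ^\<^sub>m 3 = k \<cdot>\<^sub>m 1\<^sub>m 3" and l: "(l1 + l2) * (l1 + l3) * (l2 + l3) \<noteq> 0" for k
  proof -
    have ST: "S * rho.T = A * B" using c by (simp add: B_eq rho.T_def assoc3 rho.SSS')
    have "A * B * (A * B) * (A * B) = k \<cdot>\<^sub>m 1\<^sub>m 3"
      using cube c by (simp add: numeral_3_eq_3 B_eq)
    then obtain k' where "rho.T = k' \<cdot>\<^sub>m 1\<^sub>m 3"
      using rho.T_scalar_or_trace[OF irr3 _ specA l] by (auto simp: ST)
    then show ?thesis using rho.S_multiple_of_product by (simp add: B_eq)
  qed
  show ?thesis using part_a part_b S by blast
qed


end
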